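(* Let $\mathcal M$ be a complete Riemannian manifold, $\Omega\subset\mathcal M$ a bounded domain, and let $a,b$ be as in the context. Assume there are positive numbers $\alpha$ and $s_0$ such that $$\bigl(-b'(s)s-(b(s)+1)\bigr)s^2\ge\alpha\qquad\text{for } s\ge s_0,$$ and let $K$ be a positive constant with $$K>\Bigl(\frac1\alpha\max_\Omega|\operatorname{Ric}^-|\Bigr)^{1/2}.$$ Let $u\in C^3(\Omega)$ be a solution of $|\nabla u|^2\Delta u+b(|\nabla u|)\,\nabla^2u(\nabla u,\nabla u)=0$ in $\Omega$. If the function $\exp(Ku)|\nabla u|$ attains a local maximum at an interior point $y_0$ of $\Omega$, then $|\nabla u(y_0)|\le s_0$.
   Context: $a\in C^0([0,\infty))\cap C^2((0,\infty))$ with $a(s)>0$ and $a'(s)>0$ for $s>0$; $b(s)=\frac{s a'(s)}{a(s)}-1$ for $s>0$. The equation is trivially satisfied at points where $\nabla u=0$. $\nabla^2$ is the Hessian. $\operatorname{Ric}^-(x)=\min_{|\eta|=1,\ \eta\in T_x\mathcal M}\min\{\operatorname{Ric}(\eta,\eta),0\}$. *)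

theory Defs
  imports "HOL-Analysis.Analysis"
begin

section \<open>Differentiability classes on open sets\<close>

(* C_on k f S is the class C^k on S; it is only used for open S, where continuity of all
   iterated directional derivatives up to order k is the usual notion. *)
primrec C_on :: "nat \<Rightarrow> ('a::real_normed_vector \<Rightarrow> 'b::real_normed_vector) \<Rightarrow> 'a set \<Rightarrow> bool" where
  "C_on 0 f S \<longleftrightarrow> continuous_on S f"
| "C_on (Suc k) f S \<longleftrightarrow> (\<forall>x\<in>S. f differentiable (at x)) \<and>
     (\<forall>v. C_on k (\<lambda>x. frechet_derivative f (at x) v) S)"

definition smooth_on :: "('a::real_normed_vector \<Rightarrow> 'b::real_normed_vector) \<Rightarrow> 'a set \<Rightarrow> bool" where
  "smooth_on f S \<longleftrightarrow> (\<forall>k. C_on k f S)"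

definition pd :: "'n \<Rightarrow> (real^'n \<Rightarrow> real) \<Rightarrow> real^'n \<Rightarrow> real" where
  "pd i f x = frechet_derivative f (at x) (axis i 1)"

section \<open>Riemannian manifolds\<close>

(* A chart is a pair of its domain and its coordinate map (of which only the values on the
   domain matter).  The manifold is the whole topological space 'm, its dimension is CARD('n). *)
type_synonym ('m, 'n) chart = "'m set \<times> ('m \<Rightarrow> real^'n)"

abbreviation dom_chart :: "('m, 'n) chart \<Rightarrow> 'm set" where
  "dom_chart c \<equiv> fst c"

abbreviation coords :: "('m, 'n) chart \<Rightarrow> 'm \<Rightarrow> real^'n" where
  "coords c \<equiv> snd c"

definition uncoords :: "('m, 'n) chart \<Rightarrow> real^'n \<Rightarrow> 'm" where
  "uncoords c = inv_into (dom_chart c) (coords c)"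

definition in_chart :: "('m, 'n) chart \<Rightarrow> ('m \<Rightarrow> 'a) \<Rightarrow> real^'n \<Rightarrow> 'a" where
  "in_chart c f = f \<circ> uncoords c"

(* metric M c p is the Gram matrix of the metric at p in the coordinate frame of the chart c. *)
record ('m, 'n) riemannian_structure =
  atlas :: "('m, 'n) chart set"
  metric :: "('m, 'n) chart \<Rightarrow> 'm \<Rightarrow> real^'n^'n"

definition transition :: "('m, 'n) chart \<Rightarrow> ('m, 'n) chart \<Rightarrow> real^'n \<Rightarrow> real^'n" where
  "transition c c' = in_chart c (coords c')"

definition smooth_atlas :: "('m::topological_space, 'n::finite) chart set \<Rightarrow> bool" where
  "smooth_atlas A \<longleftrightarrow>
     (\<Union>c\<in>A. dom_chart c) = UNIV \<and>
     (\<forall>c\<in>A. open (dom_chart c) \<and> open (coords c ` dom_chart c) \<and>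
        homeomorphism (dom_chart c) (coords c ` dom_chart c) (coords c) (uncoords c)) \<and>
     (\<forall>c\<in>A. \<forall>c'\<in>A. smooth_on (transition c c') (coords c ` (dom_chart c \<inter> dom_chart c')))"

definition riemannian_metric :: "('m::topological_space, 'n::finite) riemannian_structure \<Rightarrow> bool" where
  "riemannian_metric M \<longleftrightarrow>
     (\<forall>c\<in>atlas M. smooth_on (in_chart c (metric M c)) (coords c ` dom_chart c)) \<and>
     (\<forall>c\<in>atlas M. \<forall>p\<in>dom_chart c.
        transpose (metric M c p) = metric M c p \<and>
        (\<forall>v. v \<noteq> 0 \<longrightarrow> v \<bullet> (metric M c p *v v) > 0)) \<and>
     (\<forall>c\<in>atlas M. \<forall>c'\<in>atlas M. \<forall>p\<in>dom_chart c \<inter> dom_chart c'.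
        let J = matrix (frechet_derivative (transition c c') (at (coords c p)))
        in metric M c p = transpose J ** metric M c' p ** J)"

definition riemannian_manifold ::
    "('m::{t2_space, second_countable_topology}, 'n::finite) riemannian_structure \<Rightarrow> bool" where
  "riemannian_manifold M \<longleftrightarrow>
     connected (UNIV :: 'm set) \<and> smooth_atlas (atlas M) \<and> riemannian_metric M"

(* Scalars attached to a point are evaluated in some chart around it; their values do not
   depend on that choice. *)
definition chart_at :: "('m, 'n::finite) riemannian_structure \<Rightarrow> 'm \<Rightarrow> ('m, 'n) chart" where
  "chart_at M p = (SOME c. c \<in> atlas M \<and> p \<in> dom_chart c)"

definition tangent_norm ::
    "('m, 'n::finite) riemannian_structure \<Rightarrow> ('m, 'n) chart \<Rightarrow> 'm \<Rightarrow> real^'n \<Rightarrow> real" where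
  "tangent_norm M c p v = sqrt (v \<bullet> (metric M c p *v v))"

section \<open>Riemannian distance, completeness\<close>

definition C1_curve ::
    "('m::topological_space, 'n::finite) riemannian_structure \<Rightarrow> real \<Rightarrow> real \<Rightarrow> (real \<Rightarrow> 'm) \<Rightarrow> bool" where
  "C1_curve M s t \<gamma> \<longleftrightarrow> continuous_on {s..t} \<gamma> \<and>
     (\<forall>c\<in>atlas M. \<exists>D.
        continuous_on {r\<in>{s..t}. \<gamma> r \<in> dom_chart c} D \<and>
        (\<forall>r\<in>{s..t}. \<gamma> r \<in> dom_chart c \<longrightarrow>
           ((coords c \<circ> \<gamma>) has_vector_derivative D r) (at r within {s..t})))"

definition piecewise_C1_curve ::
    "('m::topological_space, 'n::finite) riemannian_structure \<Rightarrow> (real \<Rightarrow> 'm) \<Rightarrow> bool" where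
  "piecewise_C1_curve M \<gamma> \<longleftrightarrow>
     (\<exists>n (\<tau> :: nat \<Rightarrow> real). \<tau> 0 = 0 \<and> \<tau> n = 1 \<and>
        (\<forall>i<n. \<tau> i < \<tau> (Suc i) \<and> C1_curve M (\<tau> i) (\<tau> (Suc i)) \<gamma>))"

definition speed :: "('m, 'n::finite) riemannian_structure \<Rightarrow> (real \<Rightarrow> 'm) \<Rightarrow> real \<Rightarrow> real" where
  "speed M \<gamma> t =
     (let c = chart_at M (\<gamma> t)
      in tangent_norm M c (\<gamma> t) (vector_derivative (coords c \<circ> \<gamma>) (at t)))"

definition curve_length :: "('m, 'n::finite) riemannian_structure \<Rightarrow> (real \<Rightarrow> 'm) \<Rightarrow> real" where
  "curve_length M \<gamma> = integral {0..1} (speed M \<gamma>)"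

definition riemannian_dist ::
    "('m::topological_space, 'n::finite) riemannian_structure \<Rightarrow> 'm \<Rightarrow> 'm \<Rightarrow> real" where
  "riemannian_dist M p q =
     Inf {curve_length M \<gamma> |\<gamma>. piecewise_C1_curve M \<gamma> \<and> \<gamma> 0 = p \<and> \<gamma> 1 = q}"

definition complete_riemannian ::
    "('m::topological_space, 'n::finite) riemannian_structure \<Rightarrow> bool" where
  "complete_riemannian M \<longleftrightarrow> Metric_space.mcomplete UNIV (riemannian_dist M)"

definition bounded_domain ::
    "('m::topological_space, 'n::finite) riemannian_structure \<Rightarrow> 'm set \<Rightarrow> bool" where
  "bounded_domain M \<Omega> \<longleftrightarrow>
     open \<Omega> \<and> connected \<Omega> \<and> \<Omega> \<noteq> {} \<and> Metric_space.mbounded UNIV (riemannian_dist M) \<Omega>"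

section \<open>Curvature\<close>

(* Below, x ranges over coordinate values in the image of the chart c, i.e. x = coords c p. *)

definition gram :: "('m, 'n::finite) riemannian_structure \<Rightarrow> ('m, 'n) chart \<Rightarrow> real^'n \<Rightarrow> real^'n^'n" where
  "gram M c = in_chart c (metric M c)"

definition gram_inv ::
    "('m, 'n::finite) riemannian_structure \<Rightarrow> ('m, 'n) chart \<Rightarrow> real^'n \<Rightarrow> real^'n^'n" where
  "gram_inv M c x = matrix_inv (gram M c x)"

(* christoffel M c k i j is the symbol with upper index k and lower indices i, j. *)
definition christoffel ::
    "('m, 'n::finite) riemannian_structure \<Rightarrow> ('m, 'n) chart \<Rightarrow> 'n \<Rightarrow> 'n \<Rightarrow> 'n \<Rightarrow> real^'n \<Rightarrow> real" where
  "christoffel M c k i j x =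
     (1/2) * (\<Sum>l\<in>UNIV. gram_inv M c x $ k $ l *
       (pd i (\<lambda>y. gram M c y $ j $ l) x + pd j (\<lambda>y. gram M c y $ i $ l) x
        - pd l (\<lambda>y. gram M c y $ i $ j) x))"

(* riemann M c l k i j is the l-th component of R(d_i, d_j) d_k, where
   R(X,Y)Z = D_X D_Y Z - D_Y D_X Z - D_[X,Y] Z for the Levi-Civita connection D. *)
definition riemann ::
    "('m, 'n::finite) riemannian_structure \<Rightarrow> ('m, 'n) chart \<Rightarrow>
     'n \<Rightarrow> 'n \<Rightarrow> 'n \<Rightarrow> 'n \<Rightarrow> real^'n \<Rightarrow> real" where
  "riemann M c l k i j x =
     pd i (christoffel M c l j k) x - pd j (christoffel M c l i k) x
     + (\<Sum>q\<in>UNIV. christoffel M c l i q x * christoffel M c q j k x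
                 - christoffel M c l j q x * christoffel M c q i k x)"

(* Ric(Y,Z) is the trace of X |-> R(X,Y)Z, so that round spheres have positive Ricci curvature. *)
definition ricci ::
    "('m, 'n::finite) riemannian_structure \<Rightarrow> ('m, 'n) chart \<Rightarrow> real^'n \<Rightarrow> real^'n^'n" where
  "ricci M c x = (\<chi> j k. \<Sum>i\<in>UNIV. riemann M c i k i j x)"

(* The unit sphere of the tangent space is compact, so the infimum is a minimum. *)
definition ricci_minus :: "('m, 'n::finite) riemannian_structure \<Rightarrow> 'm \<Rightarrow> real" where
  "ricci_minus M p =
     (let c = chart_at M p
      in INF \<eta>\<in>{\<eta>. tangent_norm M c p \<eta> = 1}. min (\<eta> \<bullet> (ricci M c (coords c p) *v \<eta>)) 0)"

section \<open>Differential operators and the equation\<close>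

definition C_on_manifold ::
    "('m, 'n::finite) riemannian_structure \<Rightarrow> nat \<Rightarrow> ('m \<Rightarrow> real) \<Rightarrow> 'm set \<Rightarrow> bool" where
  "C_on_manifold M k u \<Omega> \<longleftrightarrow>
     (\<forall>c\<in>atlas M. C_on k (in_chart c u) (coords c ` (\<Omega> \<inter> dom_chart c)))"

definition gradient ::
    "('m, 'n::finite) riemannian_structure \<Rightarrow> ('m, 'n) chart \<Rightarrow> ('m \<Rightarrow> real) \<Rightarrow> real^'n \<Rightarrow> real^'n" where
  "gradient M c u x = gram_inv M c x *v (\<chi> j. pd j (in_chart c u) x)"

definition hessian ::
    "('m, 'n::finite) riemannian_structure \<Rightarrow> ('m, 'n) chart \<Rightarrow> ('m \<Rightarrow> real) \<Rightarrow> real^'n \<Rightarrow> real^'n^'n" where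
  "hessian M c u x =
     (\<chi> i j. pd i (pd j (in_chart c u)) x
            - (\<Sum>k\<in>UNIV. christoffel M c k i j x * pd k (in_chart c u) x))"

definition laplacian ::
    "('m, 'n::finite) riemannian_structure \<Rightarrow> ('m, 'n) chart \<Rightarrow> ('m \<Rightarrow> real) \<Rightarrow> real^'n \<Rightarrow> real" where
  "laplacian M c u x = (\<Sum>i\<in>UNIV. \<Sum>j\<in>UNIV. gram_inv M c x $ i $ j * hessian M c u x $ i $ j)"

definition grad_norm :: "('m, 'n::finite) riemannian_structure \<Rightarrow> ('m \<Rightarrow> real) \<Rightarrow> 'm \<Rightarrow> real" where
  "grad_norm M u p =
     (let c = chart_at M p in tangent_norm M c p (gradient M c u (coords c p)))"

(* The equation is required in every chart; its left-hand side does not depend on the chart.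
   Where the gradient vanishes it reads 0 = 0, whatever the value b 0. *)
definition solves_in ::
    "('m, 'n::finite) riemannian_structure \<Rightarrow> 'm set \<Rightarrow> (real \<Rightarrow> real) \<Rightarrow> ('m \<Rightarrow> real) \<Rightarrow> bool" where
  "solves_in M \<Omega> b u \<longleftrightarrow>
     (\<forall>p\<in>\<Omega>. \<forall>c\<in>atlas M. p \<in> dom_chart c \<longrightarrow>
        (let x = coords c p; X = gradient M c u x; s = tangent_norm M c p X
         in s\<^sup>2 * laplacian M c u x + b s * (X \<bullet> (hessian M c u x *v X)) = 0))"

section \<open>Square root of an extended real\<close>

definition ereal_sqrt :: "ereal \<Rightarrow> ereal" where
  "ereal_sqrt x = (case x of ereal r \<Rightarrow> ereal (sqrt r) | PInfty \<Rightarrow> \<infinity> | MInfty \<Rightarrow> -\<infinity>)"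

end

theory Submission
  imports Defs
begin

text \<open>
  Bernstein's method. Suppose \<open>s = |\<nabla>u| > s\<^sub>0\<close> at the maximum point and put \<open>w = |\<nabla>u|\<^sup>2\<close>. Criticality
  of \<open>exp (2Ku) w\<close> gives \<open>\<nabla>\<^sup>2u(\<nabla>u) = -K w \<nabla>u\<close>, so \<open>-K w\<close> is an eigenvalue of the Hessian and
  \<open>|\<nabla>\<^sup>2u|\<^sup>2 \<ge> K\<^sup>2 w\<^sup>2\<close>. Contracting the second derivatives of \<open>exp (2Ku) w\<close> with the positive
  semidefinite tensor \<open>g\<inverse> + (b/w) \<nabla>u \<otimes> \<nabla>u\<close> and removing the third derivatives of \<open>u\<close> by Bochner's
  formula and the differentiated equation leaves
  \<open>Ric(\<nabla>u, \<nabla>u) + K\<^sup>2 w\<^sup>2 (- b' s - (b + 1)) \<le> 0\<close>, which contradicts the choice of \<open>K\<close>.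
\<close>

section \<open>Calculus of partial derivatives\<close>

text \<open>The square exp (2Ku) w is tested instead of exp (Ku) |\<nabla>u| because w is a
  polynomial in the first derivatives of u with smooth coefficients: for u of class C^3 it is C^2
  and the second derivative test applies. The contracting tensor is the coefficient matrix of the
  equation divided by w. Compared with the inverse metric it scales the direction of \<nabla>u by 1
  + b and leaves the orthogonal directions alone, and 1 + b = s a'/a is positive. With this choice
  third derivatives enter the test only through \<nabla>u(\<Delta>u) + (b/w) \<nabla>u(Q), where Q
  is the Hessian applied to \<nabla>u twice; the derivative of the equation along \<nabla>u
  determines exactly this combination. No normal coordinates are needed: at a critical point the
  coordinate Hessian of a function is its covariant Hessian, so the Christoffel terms cancel in any
  chart. The threshold for K balances two bounds: Ric(\<nabla>u, \<nabla>u) is at least - w |Ric^-|,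
  and since w = s^2 the hypothesis on b makes the other term at least \<alpha> K^2 w.\<close>

lemma C_on_imp_continuous_on: "C_on k f S \<Longrightarrow> continuous_on S f"
  by (cases k) (auto intro!: continuous_at_imp_continuous_on differentiable_imp_continuous_within)

lemma C_on_SucD: "C_on (Suc k) f S \<Longrightarrow> C_on k f S"
proof (induction k arbitrary: f)
  case 0
  then show ?case using C_on_imp_continuous_on[OF 0] by simp
next
  case (Suc k)
  then show ?case by (metis C_on.simps(2))
qed

text \<open>Derivative formulas hold only at points of \<open>S\<close>, while
  \<open>frechet_derivative\<close> is taken in the whole space. Openness makes values off
  \<open>S\<close> irrelevant, so the closure lemmas below may replace a derivative by its
  formula.\<close>

lemma C_on_cong:
  assumes "open S" "\<And>x. x \<in> S \<Longrightarrow> f x = g x" "C_on k f S"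
  shows "C_on k g S"
  using assms(2,3)
proof (induction k arbitrary: f g)
  case 0
  then show ?case by (simp cong: continuous_on_cong)
next
  case (Suc k)
  have d: "g differentiable (at x)" if "x \<in> S" for x
    using Suc.prems that assms(1) has_derivative_transform_within_open[of f _ x UNIV S g]
    unfolding differentiable_def by (metis C_on.simps(2) differentiable_def)
  have "frechet_derivative f (at x) = frechet_derivative g (at x)" if "x \<in> S" for x
    using frechet_derivative_transform_within_open[of f x S g] Suc.prems that assms(1) by auto
  then show ?case
    using Suc.IH[of "\<lambda>x. frechet_derivative f (at x) v" "\<lambda>x. frechet_derivative g (at x) v" for v]
      Suc.prems(2) d by auto
qed

lemma C_on_const: "C_on k (\<lambda>x. c) S"
  by (induction k arbitrary: c) auto

lemma C_on_add:
  assumes "open S" "C_on k f S" "C_on k g S"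
  shows "C_on k (\<lambda>x. f x + g x) S"
  using assms(2,3)
proof (induction k arbitrary: f g)
  case (Suc k)
  have "C_on k (\<lambda>x. frechet_derivative (\<lambda>x. f x + g x) (at x) v) S" for v
  proof (rule C_on_cong[OF assms(1)])
    show "C_on k (\<lambda>x. frechet_derivative f (at x) v + frechet_derivative g (at x) v) S"
      using Suc by auto
    show "frechet_derivative f (at x) v + frechet_derivative g (at x) v
        = frechet_derivative (\<lambda>x. f x + g x) (at x) v" if "x \<in> S" for x
      using has_derivative_add[of f _ "at x" g] Suc.prems that
      by (metis (no_types, lifting) C_on.simps(2) frechet_derivative_at frechet_derivative_works)
  qed
  then show ?case using Suc.prems by auto
qed (auto intro: continuous_on_add)

lemma C_on_bounded_linear:
  assumes "bounded_linear L" "open S" "C_on k f S"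
  shows "C_on k (\<lambda>x. L (f x)) S"
  using assms(3)
proof (induction k arbitrary: f)
  case 0
  then show ?case using bounded_linear.continuous_on[OF assms(1)] by simp
next
  case (Suc k)
  have *: "((\<lambda>x. L (f x)) has_derivative (\<lambda>v. L (frechet_derivative f (at x) v))) (at x)"
    if "x \<in> S" for x
    using Suc.prems that bounded_linear.has_derivative[OF assms(1)]
    by (metis C_on.simps(2) frechet_derivative_works)
  have "C_on k (\<lambda>x. frechet_derivative (\<lambda>x. L (f x)) (at x) v) S" for v
    using C_on_cong[OF assms(2) _ Suc.IH] frechet_derivative_at[OF *] Suc.prems
    by (smt (verit) C_on.simps(2) C_on_cong assms(2))
  then show ?case using * by (auto simp: differentiable_def)
qed

text \<open>Leibniz's rule turns the derivative into products of other pairs of functions, so the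
  induction must keep both factors arbitrary.\<close>

lemma C_on_mult:
  fixes f g :: "'a::real_normed_vector \<Rightarrow> real"
  assumes "open S" "C_on k f S" "C_on k g S"
  shows "C_on k (\<lambda>x. f x * g x) S"
  using assms(2,3)
proof (induction k arbitrary: f g)
  case (Suc k)
  have "C_on k (\<lambda>x. frechet_derivative (\<lambda>x. f x * g x) (at x) v) S" for v
  proof (rule C_on_cong[OF assms(1)])
    show "C_on k (\<lambda>x. f x * frechet_derivative g (at x) v + frechet_derivative f (at x) v * g x) S"
      using Suc C_on_SucD[OF Suc.prems(1)] C_on_SucD[OF Suc.prems(2)]
      by (intro C_on_add assms(1) Suc.IH) auto
    show "f x * frechet_derivative g (at x) v + frechet_derivative f (at x) v * g x
        = frechet_derivative (\<lambda>x. f x * g x) (at x) v" if "x \<in> S" for x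
      using has_derivative_mult[of f _ x UNIV g] Suc.prems that
      by (metis (no_types, lifting) C_on.simps(2) frechet_derivative_at frechet_derivative_works)
  qed
  then show ?case using Suc.prems by auto
qed (auto intro: continuous_on_mult)

lemma C_on_sum:
  assumes "open S" "\<And>i. i \<in> I \<Longrightarrow> C_on k (f i) S"
  shows "C_on k (\<lambda>x. \<Sum>i\<in>I. f i x) S"
  using assms(2)
  by (induction I rule: infinite_finite_induct) (auto intro: C_on_const C_on_add assms(1))

lemma C_on_prod:
  fixes f :: "'i \<Rightarrow> 'a::real_normed_vector \<Rightarrow> real"
  assumes "open S" "\<And>i. i \<in> I \<Longrightarrow> C_on k (f i) S"
  shows "C_on k (\<lambda>x. \<Prod>i\<in>I. f i x) S"
  using assms(2)
  by (induction I rule: infinite_finite_induct) (auto intro: C_on_const C_on_mult assms(1))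

lemma C_on_diff:
  fixes f g :: "'a::real_normed_vector \<Rightarrow> real"
  assumes "open S" "C_on k f S" "C_on k g S"
  shows "C_on k (\<lambda>x. f x - g x) S"
  using C_on_add[OF assms(1,2) C_on_mult[OF assms(1) C_on_const[of k "-1"] assms(3)]] by simp

text \<open>The derivative - f'/f^2 contains the inverse itself, one class lower; the induction
  hypothesis supplies that class.\<close>

lemma C_on_inverse:
  fixes f :: "'a::real_normed_vector \<Rightarrow> real"
  assumes "open S" "C_on k f S" "\<And>x. x \<in> S \<Longrightarrow> f x \<noteq> 0"
  shows "C_on k (\<lambda>x. inverse (f x)) S"
  using assms(2)
proof (induction k)
  case 0
  then show ?case using assms(3) by (auto intro: continuous_on_inverse)
next
  case (Suc k)
  note ih = Suc.IH[OF C_on_SucD[OF Suc.prems]]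
  have "C_on k (\<lambda>x. frechet_derivative (\<lambda>x. inverse (f x)) (at x) v) S" for v
  proof (rule C_on_cong[OF assms(1)])
    show "C_on k (\<lambda>x. (- 1) * ((inverse (f x) * frechet_derivative f (at x) v) * inverse (f x))) S"
      using Suc.prems by (intro C_on_mult[OF assms(1)] C_on_const ih) auto
    show "(- 1) * ((inverse (f x) * frechet_derivative f (at x) v) * inverse (f x))
        = frechet_derivative (\<lambda>x. inverse (f x)) (at x) v" if "x \<in> S" for x
    proof -
      have "((\<lambda>x. inverse (f x)) has_derivative
          (\<lambda>h. - (inverse (f x) * frechet_derivative f (at x) h * inverse (f x)))) (at x)"
        using Suc.prems that assms(3)
        by (intro Deriv.has_derivative_inverse[where f=f and x=x and S=UNIV and f'="frechet_derivative f (at x)"])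
           (auto simp: frechet_derivative_works[symmetric])
      from frechet_derivative_at[OF this, symmetric] show ?thesis by simp
    qed
  qed
  then show ?case using Suc.prems assms(3) by (auto intro!: differentiable_inverse)
qed

lemma C_on_subset: "C_on k f S \<Longrightarrow> T \<subseteq> S \<Longrightarrow> C_on k f T"
  by (induction k arbitrary: f) (auto intro: continuous_on_subset)

section \<open>Coordinate partial derivatives\<close>

lemma pd_const: "pd i (\<lambda>y. c) x = 0"
  by (simp add: pd_def)

lemma pd_add:
  assumes "f differentiable (at x)" "g differentiable (at x)"
  shows "pd i (\<lambda>y. f y + g y) x = pd i f x + pd i g x"
proof -
  have "((\<lambda>y. f y + g y) has_derivative
      (\<lambda>h. frechet_derivative f (at x) h + frechet_derivative g (at x) h)) (at x)"
    using assms by (intro has_derivative_add) (auto simp: frechet_derivative_works)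
  from frechet_derivative_at[OF this, symmetric] show ?thesis by (simp add: pd_def)
qed

lemma pd_mult:
  assumes "f differentiable (at x)" "g differentiable (at x)"
  shows "pd i (\<lambda>y. f y * g y) x = pd i f x * g x + f x * pd i g x"
proof -
  have "((\<lambda>y. f y * g y) has_derivative
      (\<lambda>h. f x * frechet_derivative g (at x) h + frechet_derivative f (at x) h * g x)) (at x)"
    using assms by (intro has_derivative_mult) (auto simp: frechet_derivative_works)
  from frechet_derivative_at[OF this, symmetric] show ?thesis by (simp add: pd_def)
qed

lemma pd_sum:
  assumes "\<And>k. k \<in> I \<Longrightarrow> f k differentiable (at x)"
  shows "pd i (\<lambda>y. \<Sum>k\<in>I. f k y) x = (\<Sum>k\<in>I. pd i (f k) x)"
proof -
  have "((\<lambda>y. \<Sum>k\<in>I. f k y) has_derivative (\<lambda>h. \<Sum>k\<in>I. frechet_derivative (f k) (at x) h)) (at x)"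
    using assms by (intro has_derivative_sum) (auto simp: frechet_derivative_works)
  from frechet_derivative_at[OF this, symmetric] show ?thesis by (simp add: pd_def)
qed

lemma pd_cong:
  assumes "open S" "x \<in> S" "\<And>y. y \<in> S \<Longrightarrow> f y = g y" "f differentiable (at x)"
  shows "pd i f x = pd i g x"
  unfolding pd_def using frechet_derivative_transform_within_open[of f x S g] assms by metis

lemma frechet_derivative_eq_sum_pd:
  fixes f :: "real^'n \<Rightarrow> real"
  assumes "f differentiable (at x)"
  shows "frechet_derivative f (at x) v = (\<Sum>i\<in>UNIV. v $ i * pd i f x)"
proof -
  interpret linear "frechet_derivative f (at x)"
    using linear_frechet_derivative[OF assms] .
  have "frechet_derivative f (at x) v = frechet_derivative f (at x) (\<Sum>i\<in>UNIV. v $ i *s axis i 1)"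
    by (simp add: basis_expansion)
  also have "\<dots> = (\<Sum>i\<in>UNIV. v $ i * pd i f x)"
    by (simp add: sum scale pd_def scalar_mult_eq_scaleR)
  finally show ?thesis .
qed

lemma C_on_pd:
  fixes f :: "real^'n \<Rightarrow> real"
  assumes "C_on (Suc k) f S" shows "C_on k (pd i f) S"
proof -
  have "pd i f = (\<lambda>x. frechet_derivative f (at x) (axis i 1))" by (auto simp: pd_def)
  then show ?thesis using assms by simp
qed

section \<open>Restriction to lines, symmetry of second derivatives, one-variable maxima\<close>

lemma has_real_derivative_along_line:
  assumes "f differentiable (at (x + t *\<^sub>R v))"
  shows "((\<lambda>t. f (x + t *\<^sub>R v)) has_real_derivative frechet_derivative f (at (x + t *\<^sub>R v)) v) (at t)"
proof -
  have "((\<lambda>t. x + t *\<^sub>R v) has_derivative (\<lambda>h. h *\<^sub>R v)) (at t)"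
    by (auto intro!: derivative_eq_intros)
  from diff_chain_at[OF this assms[unfolded frechet_derivative_works]]
  have "((\<lambda>t. f (x + t *\<^sub>R v)) has_derivative
      (\<lambda>h. frechet_derivative f (at (x + t *\<^sub>R v)) (h *\<^sub>R v))) (at t)"
    by (simp add: o_def)
  moreover have "(\<lambda>h. frechet_derivative f (at (x + t *\<^sub>R v)) (h *\<^sub>R v))
      = (\<lambda>h. frechet_derivative f (at (x + t *\<^sub>R v)) v * h)"
    using linear_cmul[OF linear_frechet_derivative[OF assms]] by (simp add: mult.commute)
  ultimately show ?thesis by (simp add: has_field_derivative_def)
qed

text \<open>Two applications of the mean value theorem, first in direction \<open>u\<close>, then in
  direction \<open>v\<close>. The second difference is symmetric in \<open>u\<close> and
  \<open>v\<close>, whereas the derivative on the right is not visibly so.\<close>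

lemma second_difference_mvt:
  fixes f :: "'a::real_normed_vector \<Rightarrow> real"
  assumes f: "C_on 2 f (ball x d)" and h: "h > 0" "h * (norm u + norm v) < d"
  shows "\<exists>y. dist x y \<le> h * (norm u + norm v) \<and>
    f (x + h *\<^sub>R u + h *\<^sub>R v) - f (x + h *\<^sub>R u) - f (x + h *\<^sub>R v) + f x
      = h * h * frechet_derivative (\<lambda>y. frechet_derivative f (at y) u) (at y) v"
proof -
  have C: "C_on (Suc (Suc 0)) f (ball x d)" using f by (simp add: numeral_2_eq_2)
  have bound: "norm (s *\<^sub>R u + t *\<^sub>R v) \<le> h * (norm u + norm v)"
    if "0 \<le> s" "s \<le> h" "0 \<le> t" "t \<le> h" for s t
  proof -
    have "norm (s *\<^sub>R u + t *\<^sub>R v) \<le> s * norm u + t * norm v"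
      using that norm_triangle_ineq[of "s *\<^sub>R u" "t *\<^sub>R v"] by simp
    also have "\<dots> \<le> h * norm u + h * norm v"
      using that by (intro add_mono mult_right_mono) auto
    finally show ?thesis by (simp add: algebra_simps)
  qed
  have dist: "dist x (x + s *\<^sub>R u + t *\<^sub>R v) = norm (s *\<^sub>R u + t *\<^sub>R v)" for s t
    by (metis add.assoc add_diff_cancel_left' dist_norm norm_minus_commute)
  have in_ball: "x + s *\<^sub>R u + t *\<^sub>R v \<in> ball x d" if "0 \<le> s" "s \<le> h" "0 \<le> t" "t \<le> h" for s t
    using bound[OF that] h by (simp add: dist)
  \<comment> \<open>The second difference is the increment of \<open>\<phi>\<close> over the
    interval from 0 to \<open>h\<close>.\<close>
  define \<phi> where "\<phi> s = f ((x + h *\<^sub>R v) + s *\<^sub>R u) - f (x + s *\<^sub>R u)" for s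
  define \<phi>' where "\<phi>' s = frechet_derivative f (at ((x + h *\<^sub>R v) + s *\<^sub>R u)) u
      - frechet_derivative f (at (x + s *\<^sub>R u)) u" for s
  have d1: "f differentiable (at y)" if "y \<in> ball x d" for y
    using C that by auto
  have "(\<phi> has_real_derivative \<phi>' s) (at s)" if "0 \<le> s" "s \<le> h" for s
    unfolding \<phi>_def \<phi>'_def
    using in_ball[of s 0] in_ball[of s h] that h
    by (intro DERIV_diff has_real_derivative_along_line d1) (auto simp: algebra_simps)
  from MVT2[OF h(1) this] obtain \<sigma> where \<sigma>: "0 < \<sigma>" "\<sigma> < h" "\<phi> h - \<phi> 0 = h * \<phi>' \<sigma>"
    by auto
  define \<psi> where "\<psi> t = frechet_derivative f (at ((x + \<sigma> *\<^sub>R u) + t *\<^sub>R v)) u" for t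
  have d2: "(\<lambda>y. frechet_derivative f (at y) u) differentiable (at y)" if "y \<in> ball x d" for y
    using C that by auto
  have "(\<psi> has_real_derivative frechet_derivative (\<lambda>y. frechet_derivative f (at y) u)
      (at ((x + \<sigma> *\<^sub>R u) + t *\<^sub>R v)) v) (at t)" if "0 \<le> t" "t \<le> h" for t
    unfolding \<psi>_def
    using has_real_derivative_along_line[OF d2, of "x + \<sigma> *\<^sub>R u" t v] in_ball[of \<sigma> t] that \<sigma>
    by simp
  from MVT2[OF h(1) this] obtain \<tau> where \<tau>: "0 < \<tau>" "\<tau> < h" "\<psi> h - \<psi> 0 = h *
      frechet_derivative (\<lambda>y. frechet_derivative f (at y) u) (at ((x + \<sigma> *\<^sub>R u) + \<tau> *\<^sub>R v)) v"
    by auto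
  have "\<phi>' \<sigma> = \<psi> h - \<psi> 0" by (simp add: \<phi>'_def \<psi>_def algebra_simps)
  then have "\<phi> h - \<phi> 0 = h * h *
      frechet_derivative (\<lambda>y. frechet_derivative f (at y) u) (at ((x + \<sigma> *\<^sub>R u) + \<tau> *\<^sub>R v)) v"
    using \<sigma>(3) \<tau>(3) by simp
  moreover have "dist x ((x + \<sigma> *\<^sub>R u) + \<tau> *\<^sub>R v) \<le> h * (norm u + norm v)"
    using bound[of \<sigma> \<tau>] \<sigma> \<tau> by (simp add: dist)
  ultimately show ?thesis
    by (intro exI[of _ "(x + \<sigma> *\<^sub>R u) + \<tau> *\<^sub>R v"]) (simp add: \<phi>_def algebra_simps)
qed

text \<open>By the symmetry of the second difference, the two mixed derivatives agree at two
  possibly different points near \<open>x\<close>. Continuity of both brings the equality to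
  \<open>x\<close>.\<close>

lemma second_derivative_symmetric:
  fixes f :: "'a::real_normed_vector \<Rightarrow> real"
  assumes "open S" "x \<in> S" and f: "C_on 2 f S"
  shows "frechet_derivative (\<lambda>y. frechet_derivative f (at y) u) (at x) v
       = frechet_derivative (\<lambda>y. frechet_derivative f (at y) v) (at x) u"
proof -
  define A where "A u v y = frechet_derivative (\<lambda>y. frechet_derivative f (at y) u) (at y) v" for u v y
  have cont: "isCont (A u v) x" for u v
  proof -
    have "continuous_on S (A u v)"
      using f unfolding A_def by (simp add: numeral_2_eq_2)
    then show ?thesis using assms continuous_on_eq_continuous_at by blast
  qed
  have "\<bar>A u v x - A v u x\<bar> < e" if e: "e > 0" for e
  proof -
    obtain r where r: "r > 0" "ball x r \<subseteq> S" using assms openE by blast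
    obtain d1 where d1: "d1 > 0" "\<And>y. dist y x < d1 \<Longrightarrow> dist (A u v y) (A u v x) < e / 2"
      using cont[of u v] e unfolding continuous_at_eps_delta
      by (metis half_gt_zero_iff)
    obtain d2 where d2: "d2 > 0" "\<And>y. dist y x < d2 \<Longrightarrow> dist (A v u y) (A v u x) < e / 2"
      using cont[of v u] e unfolding continuous_at_eps_delta
      by (metis half_gt_zero_iff)
    define d where "d = min r (min d1 d2)"
    \<comment> \<open>The summand 1 covers \<open>u = v = 0\<close>; the factor 2 leaves the
      increments strictly inside the ball of radius \<open>d\<close>.\<close>
    define h where "h = d / (2 * (norm u + norm v + 1))"
    have pos: "d > 0" using r d1 d2 by (simp add: d_def)
    have h: "h > 0" using pos by (auto simp: h_def intro!: divide_pos_pos add_nonneg_pos)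
    have "h * (norm u + norm v) \<le> h * (norm u + norm v + 1)" using h by simp
    also have "\<dots> = d / 2"
    proof -
      have "norm u + norm v + 1 \<noteq> 0" by (smt (verit) norm_ge_zero)
      then show ?thesis by (simp add: h_def field_simps)
    qed
    finally have hd: "h * (norm u + norm v) < d" using pos by simp
    have "ball x d \<subseteq> ball x r" by (auto simp: d_def)
    then have C: "C_on 2 f (ball x d)" using f r C_on_subset[of 2 f S] by blast
    obtain y where y: "dist x y \<le> h * (norm u + norm v)"
      "f (x + h *\<^sub>R u + h *\<^sub>R v) - f (x + h *\<^sub>R u) - f (x + h *\<^sub>R v) + f x = h * h * A u v y"
      using second_difference_mvt[OF C h hd] unfolding A_def by blast
    have hd': "h * (norm v + norm u) < d" using hd by (simp add: add.commute)
    obtain z where z: "dist x z \<le> h * (norm v + norm u)"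
      "f (x + h *\<^sub>R v + h *\<^sub>R u) - f (x + h *\<^sub>R v) - f (x + h *\<^sub>R u) + f x = h * h * A v u z"
      using second_difference_mvt[OF C h hd'] unfolding A_def by blast
    have "h * h * A u v y = h * h * A v u z"
      using y(2) z(2) by (simp add: algebra_simps)
    then have "A u v y = A v u z" using h by simp
    moreover have "dist (A u v y) (A u v x) < e / 2"
      using y(1) hd d1(2)[of y] by (simp add: d_def dist_commute)
    moreover have "dist (A v u z) (A v u x) < e / 2"
      using z(1) hd' d2(2)[of z] by (simp add: d_def dist_commute)
    ultimately show ?thesis unfolding dist_real_def by linarith
  qed
  then have "A u v x = A v u x"
    by (metis abs_ge_zero less_irrefl not_less_iff_gr_or_eq right_minus_eq zero_less_abs_iff)
  then show ?thesis by (simp add: A_def)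
qed

lemma pd_commute:
  fixes f :: "real^'n \<Rightarrow> real"
  assumes "open S" "x \<in> S" "C_on 2 f S"
  shows "pd i (pd j f) x = pd j (pd i f) x"
proof -
  have "pd k f = (\<lambda>y. frechet_derivative f (at y) (axis k 1))" for k
    by (auto simp: pd_def)
  then show ?thesis
    using second_derivative_symmetric[OF assms] by (simp add: pd_def)
qed

text \<open>If \<open>D\<close> were positive, \<open>\<phi>'\<close> would be positive just to the
  right of 0 and \<open>\<phi>\<close> would exceed its maximum. The second derivative is required
  at 0 only.\<close>

lemma local_max_derivatives:
  fixes \<phi> :: "real \<Rightarrow> real"
  assumes d: "d > 0" and \<phi>': "\<And>t. \<bar>t\<bar> < d \<Longrightarrow> (\<phi> has_real_derivative \<phi>' t) (at t)"
    and D: "(\<phi>' has_real_derivative D) (at 0)"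
    and max: "\<And>t. \<bar>t\<bar> < d \<Longrightarrow> \<phi> t \<le> \<phi> 0"
  shows "\<phi>' 0 = 0" "D \<le> 0"
proof -
  show 0: "\<phi>' 0 = 0"
    using DERIV_local_max[OF \<phi>'[of 0] d] max d by auto
  show "D \<le> 0"
  proof (rule ccontr)
    assume "\<not> D \<le> 0"
    then obtain e where e: "e > 0" "\<And>h. h > 0 \<Longrightarrow> h < e \<Longrightarrow> \<phi>' 0 < \<phi>' h"
      using DERIV_pos_inc_right[OF D] by auto
    define t where "t = min d e / 2"
    have t: "0 < t" "t < d" "t < e" using d e(1) by (auto simp: t_def)
    obtain z where "0 < z" "z < t" "\<phi> t - \<phi> 0 = (t - 0) * \<phi>' z"
      using MVT2[OF t(1), of \<phi> \<phi>'] \<phi>' t by auto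
    moreover from this have "\<phi>' z > 0" using e(2)[of z] t 0 by auto
    ultimately have "\<phi> t > \<phi> 0" using t(1) by (simp add: algebra_simps)
    then show False using max[of t] t by auto
  qed
qed

section \<open>Quadratic forms and inverse matrices\<close>

abbreviation qform :: "('n::finite \<Rightarrow> 'n \<Rightarrow> real) \<Rightarrow> ('n \<Rightarrow> real) \<Rightarrow> ('n \<Rightarrow> real) \<Rightarrow> real" where
  "qform P u v \<equiv> \<Sum>i\<in>UNIV. \<Sum>j\<in>UNIV. P i j * u i * v j"

lemma nonneg_quadratic_discriminant:
  fixes a b c :: real
  assumes "\<And>t. 0 \<le> c + 2 * b * t + a * t\<^sup>2"
  shows "b\<^sup>2 \<le> a * c"
proof (cases "a = 0")
  case True
  have "b = 0"
  proof (rule ccontr)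
    assume "b \<noteq> 0"
    \<comment> \<open>At this \<open>t\<close> the affine function takes the value -1.\<close>
    then show False using assms[of "- (c + 1) / (2 * b)"] True by (simp add: field_simps)
  qed
  then show ?thesis using True by simp
next
  case False
  have "a > 0"
  proof (rule ccontr)
    assume "\<not> a > 0"
    then have a: "a < 0" using False by simp
    \<comment> \<open>For negative \<open>a\<close> this \<open>t\<close> makes \<open>a * t\<close>
      smaller than \<open>- (\<bar>c\<bar> + 2 * \<bar>b\<bar> + 1)\<close> while
      \<open>t \<ge> 1\<close>, so the quadratic term wins.\<close>
    define t where "t = (\<bar>c\<bar> + 2 * \<bar>b\<bar> + 1) / (- a) + 1"
    have t: "t \<ge> 1" using a by (auto simp: t_def intro!: divide_nonneg_neg divide_nonpos_neg)
    have at: "a * t = - (\<bar>c\<bar> + 2 * \<bar>b\<bar> + 1) + a" using a by (simp add: t_def field_simps)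
    have "c + 2 * b * t + a * t\<^sup>2 = c + (2 * b + a * t) * t" by (simp add: power2_eq_square algebra_simps)
    also have "\<dots> \<le> c + (- \<bar>c\<bar> - 1 + a) * t"
      using t at by (intro add_left_mono mult_right_mono) auto
    also have "\<dots> \<le> c + (- \<bar>c\<bar> - 1 + a) * 1"
      using t a by (intro add_left_mono mult_left_mono_neg) auto
    also have "\<dots> < 0" using a by auto
    finally show False using assms[of t] by simp
  qed
  \<comment> \<open>The minimiser of the parabola.\<close>
  then show ?thesis using assms[of "- b / a"] by (simp add: field_simps power2_eq_square)
qed

lemma qform_add_scaled:
  assumes "\<And>i j. P i j = P j i"
  shows "qform P (\<lambda>i. u i + t * v i) (\<lambda>i. u i + t * v i)
      = qform P u u + 2 * qform P u v * t + qform P v v * t\<^sup>2"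
proof -
  have "qform P v u = qform P u v"
    by (subst sum.swap) (simp add: assms mult.commute mult.left_commute)
  moreover have "qform P (\<lambda>i. u i + t * v i) (\<lambda>i. u i + t * v i)
      = qform P u u + t * qform P u v + t * qform P v u + t * t * qform P v v"
    by (simp add: sum_distrib_left sum.distrib[symmetric] algebra_simps)
  ultimately show ?thesis by (simp add: power2_eq_square algebra_simps)
qed

text \<open>The form may be degenerate: each remainder in the Cholesky induction below has a
  vanishing diagonal entry.\<close>

lemma qform_Cauchy_Schwarz:
  assumes "\<And>i j. P i j = P j i" "\<And>v. 0 \<le> qform P v v"
  shows "(qform P u v)\<^sup>2 \<le> qform P u u * qform P v v"
proof -
  have "0 \<le> qform P u u + 2 * qform P u v * t + qform P v v * t\<^sup>2" for t
    using assms(2)[of "\<lambda>i. u i + t * v i"]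
    unfolding qform_add_scaled[where u=u and v=v and t=t and P=P, OF assms(1)] .
  from nonneg_quadratic_discriminant[OF this] show ?thesis by (simp only: mult.commute)
qed

lemma qform_indicator:
  "qform P (\<lambda>j. if j = i then 1 else 0) v = (\<Sum>j\<in>UNIV. P i j * v j)"
proof -
  have "qform P (\<lambda>j. if j = i then 1 else 0) v
      = (\<Sum>a\<in>UNIV. if a = i then \<Sum>j\<in>UNIV. P a j * v j else 0)"
    by (intro sum.cong) auto
  then show ?thesis by simp
qed

text \<open>The induction removes one rank-one summand of \<open>P\<close> at a time (Cholesky factorisation).\<close>

lemma sum_mult_psd_nsd_nonpos:
  fixes P N :: "'n::finite \<Rightarrow> 'n \<Rightarrow> real"
  assumes "\<And>i j. P i j = P j i" "\<And>v. 0 \<le> qform P v v" "\<And>v. qform N v v \<le> 0"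
  shows "(\<Sum>i\<in>UNIV. \<Sum>j\<in>UNIV. P i j * N i j) \<le> 0"
  using assms(1,2)
proof (induction "card {i. P i i \<noteq> 0}" arbitrary: P rule: less_induct)
  case (less P)
  note sym = less.prems(1) and psd = less.prems(2)
  let ?e = "\<lambda>i j. if j = i then 1 else 0 :: real"
  have diag: "qform P (?e i) (?e i) = P i i" for i
    by (simp add: qform_indicator if_distrib[of "\<lambda>x. _ * x"] cong: if_cong)
  have cs: "(\<Sum>j\<in>UNIV. P i j * v j)\<^sup>2 \<le> P i i * qform P v v" for i v
    using qform_Cauchy_Schwarz[OF sym psd, of "?e i" v] unfolding diag unfolding qform_indicator .
  \<comment> \<open>A zero on the diagonal kills its whole row. Hence \<open>P = 0\<close> once the
    diagonal vanishes, and zeros already obtained survive the subtraction below, so the number of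
    nonzero diagonal entries drops.\<close>
  have entry: "(P i k)\<^sup>2 \<le> P i i * P k k" for i k
    using cs[of i "?e k"] unfolding diag
    by (simp add: if_distrib[of "\<lambda>x. _ * x"] cong: if_cong)
  show ?case
  proof (cases "\<forall>i. P i i = 0")
    case True
    then have "P i k = 0" for i k using entry[of i k] by simp
    then show ?thesis by simp
  next
    case False
    then obtain i where i: "P i i \<noteq> 0" by blast
    have pos: "P i i > 0" using psd[of "?e i"] i unfolding diag by simp
    \<comment> \<open>The Schur complement of the pivot \<open>P i i\<close>. It stays positive
      semidefinite by \<open>cs\<close>, which is Cauchy-Schwarz against the \<open>i\<close>-th
      unit vector.\<close>
    define P' where "P' j k = P j k - P i j * P i k / P i i" for j k
    have "qform P' v v = qform P v v - (\<Sum>j\<in>UNIV. P i j * v j)\<^sup>2 / P i i" for v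
      by (simp add: P'_def power2_eq_square sum_product sum_divide_distrib sum_subtractf[symmetric]
          algebra_simps)
    then have psd': "0 \<le> qform P' v v" for v
      using cs[of i v] pos by (simp only: diff_ge_0_iff_ge pos_divide_le_eq mult.commute)
    have "P' k k = 0" if "P k k = 0" for k
      using entry[of i k] that by (simp add: P'_def)
    moreover have "P' i i = 0" using i by (simp add: P'_def)
    ultimately have "{k. P' k k \<noteq> 0} \<subset> {k. P k k \<noteq> 0}" using i by blast
    then have "card {k. P' k k \<noteq> 0} < card {k. P k k \<noteq> 0}"
      by (intro psubset_card_mono) auto
    moreover have "P' j k = P' k j" for j k by (simp add: P'_def sym mult.commute)
    ultimately have le: "(\<Sum>j\<in>UNIV. \<Sum>k\<in>UNIV. P' j k * N j k) \<le> 0"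
      using psd' by (rule less.hyps)
    \<comment> \<open>The rank-one part that was removed contributes the value of the form
      \<open>N\<close> on row \<open>i\<close> of \<open>P\<close>, divided by the pivot.\<close>
    have "(\<Sum>j\<in>UNIV. \<Sum>k\<in>UNIV. P j k * N j k)
        = (\<Sum>j\<in>UNIV. \<Sum>k\<in>UNIV. P' j k * N j k) + qform N (P i) (P i) / P i i"
      by (simp add: P'_def sum_divide_distrib sum.distrib[symmetric] algebra_simps)
    also have "\<dots> \<le> 0" using le assms(3)[of "P i"] pos
      by (simp add: add_nonpos_nonpos divide_nonpos_pos)
    finally show ?thesis .
  qed
qed

text \<open>\<open>T = h H\<close> is self-adjoint for \<open>h\<close>, so the trace of its square is the sum of the squares of
  its eigenvalues.\<close>

lemma trace_square_ge_eigenvalue_square: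
  fixes h H :: "'n::finite \<Rightarrow> 'n \<Rightarrow> real"
  assumes h: "\<And>i j. h i j = h j i" "\<And>v. 0 \<le> qform h v v"
    and H: "\<And>i j. H i j = H j i"
    and T: "\<And>i k. T i k = (\<Sum>j\<in>UNIV. h i j * H j k)"
    and pos: "qform h f f > 0"
    and eig: "\<And>k. (\<Sum>i\<in>UNIV. T i k * f i) = \<mu> * f k"
  shows "\<mu>\<^sup>2 \<le> (\<Sum>i\<in>UNIV. \<Sum>k\<in>UNIV. T i k * T k i)"
proof -
  define w where "w = qform h f f"
  have w: "w > 0" using pos by (simp add: w_def)
  \<comment> \<open>As a matrix this is (\<mu>^2/w) f f^T - H h H. It is negative semidefinite by
    Cauchy-Schwarz for \<open>h\<close> applied to \<open>f\<close> and \<open>H v\<close>, because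
    the eigenvalue equation gives h(f, H v) = \<mu> (f . v). Its trace against \<open>h\<close> is
    \<mu>^2 minus the trace of T^2.\<close>
  define N where "N i j = \<mu>\<^sup>2 / w * (f i * f j) - (\<Sum>k\<in>UNIV. H i k * T k j)" for i j
  have nsd: "qform N v v \<le> 0" for v
  proof -
    define Hv where "Hv i = (\<Sum>j\<in>UNIV. H i j * v j)" for i
    have self_adj: "(\<Sum>i\<in>UNIV. v i * (\<Sum>k\<in>UNIV. H i k * y k)) = (\<Sum>k\<in>UNIV. Hv k * y k)" for y
      unfolding Hv_def sum_distrib_left sum_distrib_right
      by (subst sum.swap) (simp add: H ac_simps)
    have Tv: "(\<Sum>k\<in>UNIV. T i k * v k) = (\<Sum>j\<in>UNIV. h i j * Hv j)" for i
      unfolding T Hv_def sum_distrib_left sum_distrib_right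
      by (subst sum.swap) (simp add: mult.assoc)
    have "qform h f Hv = (\<Sum>i\<in>UNIV. f i * (\<Sum>j\<in>UNIV. h i j * Hv j))"
      by (simp add: sum_distrib_left algebra_simps)
    also have "\<dots> = (\<Sum>i\<in>UNIV. f i * (\<Sum>k\<in>UNIV. T i k * v k))" by (simp add: Tv)
    also have "\<dots> = (\<Sum>k\<in>UNIV. (\<Sum>i\<in>UNIV. T i k * f i) * v k)"
      unfolding sum_distrib_left sum_distrib_right
      by (subst sum.swap) (simp add: algebra_simps)
    also have "\<dots> = \<mu> * (\<Sum>k\<in>UNIV. f k * v k)"
      by (simp only: eig sum_distrib_left mult.assoc)
    finally have 1: "qform h f Hv = \<mu> * (\<Sum>k\<in>UNIV. f k * v k)" .
    have "qform (\<lambda>i j. \<Sum>k\<in>UNIV. H i k * T k j) v v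
        = (\<Sum>i\<in>UNIV. v i * (\<Sum>k\<in>UNIV. H i k * (\<Sum>j\<in>UNIV. T k j * v j)))"
    proof (rule sum.cong[OF refl])
      fix i
      show "(\<Sum>j\<in>UNIV. (\<Sum>k\<in>UNIV. H i k * T k j) * v i * v j)
          = v i * (\<Sum>k\<in>UNIV. H i k * (\<Sum>j\<in>UNIV. T k j * v j))"
        unfolding sum_distrib_left sum_distrib_right
        by (subst sum.swap) (simp add: algebra_simps)
    qed
    also have "\<dots> = (\<Sum>k\<in>UNIV. Hv k * (\<Sum>j\<in>UNIV. h k j * Hv j))"
      unfolding Tv by (rule self_adj)
    also have "\<dots> = qform h Hv Hv" by (simp add: sum_distrib_left algebra_simps)
    finally have 2: "qform (\<lambda>i j. \<Sum>k\<in>UNIV. H i k * T k j) v v = qform h Hv Hv" .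
    have "qform N v v = \<mu>\<^sup>2 / w * (\<Sum>k\<in>UNIV. f k * v k)\<^sup>2 - qform (\<lambda>i j. \<Sum>k\<in>UNIV. H i k * T k j) v v"
      by (simp add: N_def power2_eq_square sum_product sum_distrib_left sum_subtractf[symmetric] algebra_simps)
    also have "\<dots> = (qform h f Hv)\<^sup>2 / w - qform h Hv Hv"
      unfolding 1 2 by (simp add: power_mult_distrib)
    also have "\<dots> \<le> 0"
      using qform_Cauchy_Schwarz[OF h, of f Hv]
      unfolding w_def[symmetric] diff_le_0_iff_le pos_divide_le_eq[OF w] by (simp only: mult.commute)
    finally show ?thesis .
  qed
  have "(\<Sum>i\<in>UNIV. \<Sum>j\<in>UNIV. h i j * N i j)
      = \<mu>\<^sup>2 / w * qform h f f - (\<Sum>i\<in>UNIV. \<Sum>j\<in>UNIV. \<Sum>k\<in>UNIV. h i j * H i k * T k j)"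
    by (simp add: N_def sum_distrib_left sum_subtractf[symmetric] algebra_simps)
  also have "(\<Sum>i\<in>UNIV. \<Sum>j\<in>UNIV. \<Sum>k\<in>UNIV. h i j * H i k * T k j)
      = (\<Sum>j\<in>UNIV. \<Sum>k\<in>UNIV. (\<Sum>i\<in>UNIV. h j i * H i k) * T k j)"
  proof -
    have "(\<Sum>i\<in>UNIV. \<Sum>j\<in>UNIV. \<Sum>k\<in>UNIV. h i j * H i k * T k j)
        = (\<Sum>j\<in>UNIV. \<Sum>i\<in>UNIV. \<Sum>k\<in>UNIV. h i j * H i k * T k j)" by (rule sum.swap)
    also have "\<dots> = (\<Sum>j\<in>UNIV. \<Sum>k\<in>UNIV. \<Sum>i\<in>UNIV. h i j * H i k * T k j)"
      by (intro sum.cong refl sum.swap)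
    finally show ?thesis by (simp add: sum_distrib_right h(1))
  qed
  also have "\<dots> = (\<Sum>j\<in>UNIV. \<Sum>k\<in>UNIV. T j k * T k j)" by (simp add: T)
  finally show ?thesis
    using sum_mult_psd_nsd_nonpos[OF h nsd] w by (simp add: w_def[symmetric])
qed

section \<open>Inverse matrices: positivity, smooth dependence, congruence\<close>

lemma posdef_invertible:
  fixes A :: "real^'n^'n"
  assumes "\<And>v. v \<noteq> 0 \<Longrightarrow> v \<bullet> (A *v v) > 0"
  shows "invertible A"
proof -
  have "\<forall>x. A *v x = 0 \<longrightarrow> x = 0" using assms by force
  then show ?thesis by (simp add: invertible_left_inverse matrix_left_invertible_ker)
qed

lemma matrix_inv_mult:
  fixes A :: "real^'n^'n"
  assumes "invertible A"
  shows "A ** matrix_inv A = mat 1" "matrix_inv A ** A = mat 1"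
  using someI_ex[OF assms[unfolded invertible_def]] unfolding matrix_inv_def by auto

lemma matrix_inv_symmetric:
  fixes A :: "real^'n^'n"
  assumes "invertible A" "transpose A = A"
  shows "transpose (matrix_inv A) = matrix_inv A"
proof -
  have "transpose (matrix_inv A) ** A = mat 1"
    by (metis assms matrix_inv_mult(1) matrix_transpose_mul transpose_mat)
  then show ?thesis
    by (metis assms(1) matrix_inv_mult(1) matrix_mul_assoc matrix_mul_lid matrix_mul_rid)
qed

lemma matrix_inv_posdef:
  fixes A :: "real^'n^'n"
  assumes A: "\<And>v. v \<noteq> 0 \<Longrightarrow> v \<bullet> (A *v v) > 0" and v: "v \<noteq> 0"
  shows "v \<bullet> (matrix_inv A *v v) > 0"
proof -
  have inv: "invertible A" using posdef_invertible A by blast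
  have eq: "A *v (matrix_inv A *v v) = v"
    by (simp add: matrix_vector_mul_assoc matrix_inv_mult[OF inv])
  then have "matrix_inv A *v v \<noteq> 0" using v by (metis matrix_vector_mult_0_right)
  from A[OF this] show ?thesis by (simp add: eq inner_commute)
qed

text \<open>Cramer's rule. It makes the entries of the inverse rational in those of
  \<open>A\<close>, so that their C^k regularity follows from that of sums, products and
  reciprocals.\<close>

lemma matrix_inv_entry_det:
  fixes A :: "real^'n^'n"
  assumes "invertible A"
  shows "matrix_inv A $ k $ j
    = det (\<chi> i l. if l = k then axis j 1 $ i else A $ i $ l) * inverse (det A)"
proof -
  have "A *v (matrix_inv A *v axis j 1) = axis j 1"
    by (simp add: matrix_vector_mul_assoc matrix_inv_mult[OF assms])
  then have "matrix_inv A *v axis j 1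
      = (\<chi> k. det (\<chi> i l. if l = k then axis j 1 $ i else A $ i $ l) / det A)"
    using cramer[of A] assms by (simp add: invertible_det_nz)
  moreover have "(matrix_inv A *v axis j 1) $ k = matrix_inv A $ k $ j"
    by (simp add: matrix_vector_mult_basis column_def)
  ultimately show ?thesis by (simp add: field_simps)
qed

lemma C_on_det:
  fixes A :: "'a::real_normed_vector \<Rightarrow> real^'n^'n"
  assumes "open S" "\<And>i j. C_on k (\<lambda>x. A x $ i $ j) S"
  shows "C_on k (\<lambda>x. det (A x)) S"
  unfolding det_def by (intro C_on_sum C_on_mult C_on_prod C_on_const assms)

lemma C_on_matrix_inv_entry:
  fixes A :: "'a::real_normed_vector \<Rightarrow> real^'n^'n"
  assumes S: "open S" and A: "\<And>i j. C_on k (\<lambda>x. A x $ i $ j) S"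
    and inv: "\<And>x. x \<in> S \<Longrightarrow> invertible (A x)"
  shows "C_on k (\<lambda>x. matrix_inv (A x) $ i $ j) S"
proof (rule C_on_cong[OF S matrix_inv_entry_det[OF inv, symmetric]])
  have "C_on k (\<lambda>x. (\<chi> a l. if l = i then axis j 1 $ a else A x $ a $ l) $ a $ b) S" for a b
    by (cases "b = i") (auto intro: C_on_const A)
  then show "C_on k (\<lambda>x. det (\<chi> a l. if l = i then axis j 1 $ a else A x $ a $ l) * inverse (det (A x))) S"
    using inv by (intro C_on_mult C_on_inverse C_on_det S A) (auto simp: invertible_det_nz)
qed

text \<open>Coordinate change for the dual norm: the covector \<open>f'\<close> is pulled back by
  \<open>J\<close>, the vector dual to \<open>f\<close> is pushed forward by \<open>J\<close>, and
  their pairing is unchanged.\<close>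

lemma inner_inverse_congruence:
  fixes G G' J :: "real^'n^'n"
  assumes G: "G = transpose J ** G' ** J" and inv: "invertible G" "invertible G'"
    and f: "f = transpose J *v f'"
  shows "f \<bullet> (matrix_inv G *v f) = f' \<bullet> (matrix_inv G' *v f')"
proof -
  \<comment> \<open>Determinants give invertibility of the Jacobian without the inverse transition
    map.\<close>
  have "det G = det J * det G' * det J" by (simp add: G det_mul)
  then have "invertible (transpose J)" using inv by (auto simp: invertible_det_nz)
  then have inj: "transpose J *v a = transpose J *v b \<Longrightarrow> a = b" for a b
    by (metis matrix_inv_mult(2) matrix_vector_mul_assoc matrix_vector_mul_lid)
  define X where "X = matrix_inv G *v f"
  have "transpose J *v (G' *v (J *v X)) = G *v X"
    by (simp add: G matrix_vector_mul_assoc matrix_mul_assoc)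
  also have "\<dots> = transpose J *v f'"
    unfolding X_def f by (simp add: matrix_vector_mul_assoc[of G] matrix_inv_mult[OF inv(1)])
  finally have "G' *v (J *v X) = f'" by (rule inj)
  then have JX: "J *v X = matrix_inv G' *v f'"
    by (metis inv(2) matrix_inv_mult(2) matrix_vector_mul_assoc matrix_vector_mul_lid)
  have "f \<bullet> X = f' \<bullet> (J *v X)" unfolding f by (simp add: dot_lmul_matrix)
  then show ?thesis by (simp add: X_def[symmetric] JX)
qed

section \<open>Levi-Civita connection in a chart\<close>

text \<open>Only coordinate values occur here, so the tensor calculus is free of the manifold.
  \<open>U\<close> is later the coordinate image of the part of \<Omega> inside one chart.\<close>

locale riemannian_chart =
  fixes M :: "('m, 'n::finite) riemannian_structure" and c :: "('m, 'n) chart"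
    and U :: "(real^'n) set"
  assumes open_U: "open U"
    and C_on_gram: "\<And>k i j. C_on k (\<lambda>x. gram M c x $ i $ j) U"
    and transpose_gram: "\<And>x. x \<in> U \<Longrightarrow> transpose (gram M c x) = gram M c x"
    and gram_posdef: "\<And>x v. x \<in> U \<Longrightarrow> v \<noteq> 0 \<Longrightarrow> v \<bullet> (gram M c x *v v) > 0"
begin

abbreviation g :: "'n \<Rightarrow> 'n \<Rightarrow> real^'n \<Rightarrow> real" where
  "g i j x \<equiv> gram M c x $ i $ j"

abbreviation h :: "'n \<Rightarrow> 'n \<Rightarrow> real^'n \<Rightarrow> real" where
  "h i j x \<equiv> gram_inv M c x $ i $ j"

abbreviation \<Gamma> :: "'n \<Rightarrow> 'n \<Rightarrow> 'n \<Rightarrow> real^'n \<Rightarrow> real" where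
  "\<Gamma> \<equiv> christoffel M c"

lemma invertible_gram: "x \<in> U \<Longrightarrow> invertible (gram M c x)"
  using posdef_invertible gram_posdef by blast

lemma g_sym: "x \<in> U \<Longrightarrow> g i j x = g j i x"
  using arg_cong[OF transpose_gram, of x "\<lambda>A. A $ j $ i"] by (simp add: transpose_def)

lemma h_sym: "x \<in> U \<Longrightarrow> h i j x = h j i x"
  using arg_cong[OF matrix_inv_symmetric[OF invertible_gram transpose_gram], of x "\<lambda>A. A $ j $ i"]
  by (simp add: gram_inv_def transpose_def)

lemma g_h: "x \<in> U \<Longrightarrow> (\<Sum>b\<in>UNIV. g a b x * h b k x) = (if a = k then 1 else 0)"
  using arg_cong[OF matrix_inv_mult(1)[OF invertible_gram], of x "\<lambda>A. A $ a $ k"]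
  by (simp add: gram_inv_def matrix_matrix_mult_def mat_def)

lemma h_g: "x \<in> U \<Longrightarrow> (\<Sum>b\<in>UNIV. h a b x * g b k x) = (if a = k then 1 else 0)"
  using arg_cong[OF matrix_inv_mult(2)[OF invertible_gram], of x "\<lambda>A. A $ a $ k"]
  by (simp add: gram_inv_def matrix_matrix_mult_def mat_def)

lemma C_on_h: "C_on k (h i j) U"
  unfolding gram_inv_def by (intro C_on_matrix_inv_entry open_U C_on_gram invertible_gram)

lemma C_on_\<Gamma>: "C_on k (\<Gamma> i j l) U"
proof -
  have "C_on k (pd i (g a b)) U" for i a b using C_on_pd[OF C_on_gram[of "Suc k"]] .
  then show ?thesis unfolding christoffel_def[abs_def]
    by (intro C_on_mult C_on_const C_on_sum C_on_diff C_on_add C_on_h open_U)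
qed

lemma h_quadratic_nonneg:
  assumes "x \<in> U"
  shows "0 \<le> qform (\<lambda>i j. h i j x) v v"
proof -
  have *: "qform (\<lambda>i j. h i j x) v v = (\<chi> i. v i) \<bullet> (gram_inv M c x *v (\<chi> i. v i))"
    by (simp add: inner_vec_def matrix_vector_mult_def sum_distrib_left algebra_simps)
  show ?thesis
    unfolding * unfolding gram_inv_def using assms
    by (cases "(\<chi> i. v i) = 0") (auto intro!: less_imp_le matrix_inv_posdef gram_posdef)
qed

lemma C_on_imp_differentiable: "C_on (Suc k) f U \<Longrightarrow> x \<in> U \<Longrightarrow> f differentiable (at x)"
  by simp

lemmas differentiable_g = C_on_imp_differentiable[OF C_on_gram]
lemmas differentiable_h = C_on_imp_differentiable[OF C_on_h]
lemmas differentiable_\<Gamma> = C_on_imp_differentiable[OF C_on_\<Gamma>]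

lemma pd_g_sym: "x \<in> U \<Longrightarrow> pd i (g a b) x = pd i (g b a) x"
  by (intro pd_cong[OF open_U] g_sym differentiable_g)

lemma \<Gamma>_sym: "x \<in> U \<Longrightarrow> \<Gamma> k i j x = \<Gamma> k j i x"
  unfolding christoffel_def using pd_g_sym[of x _ i j] by (simp add: add.commute)

text \<open>The inverse metric is parallel. Differentiating g h = 1 reduces this to the
  corresponding fact for \<open>g\<close>.\<close>

lemma pd_h:
  assumes x: "x \<in> U"
  shows "pd i (h j k) x = - (\<Sum>l\<in>UNIV. \<Gamma> j i l x * h l k x) - (\<Sum>l\<in>UNIV. \<Gamma> k i l x * h j l x)"
proof -
  \<comment> \<open>Christoffel symbols of the first kind, the lowered index being \<open>l\<close>.
    In these terms \<open>dg\<close> below is the compatibility of the connection with the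
    metric.\<close>
  define L where "L l a b = (1/2) * (pd a (g b l) x + pd b (g a l) x - pd l (g a b) x)" for l a b
  have \<Gamma>: "\<Gamma> k a b x = (\<Sum>l\<in>UNIV. h k l x * L l a b)" for k a b
    by (simp add: christoffel_def L_def sum_distrib_left mult.left_commute)
  have dg: "pd i (g a b) x = L a i b + L b i a" for a b
    using pd_g_sym[OF x] by (simp add: L_def field_simps)
  have dgh: "(\<Sum>b\<in>UNIV. g a b x * pd i (h b k) x) = - (\<Sum>b\<in>UNIV. pd i (g a b) x * h b k x)" for a
  proof -
    have "pd i (\<lambda>y. \<Sum>b\<in>UNIV. g a b y * h b k y) x = pd i (\<lambda>y. if a = k then 1 else 0) x"
      by (rule pd_cong[OF open_U x g_h])
        (auto intro!: differentiable_sum differentiable_mult differentiable_g[OF x] differentiable_h[OF x])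
    then have "(\<Sum>b\<in>UNIV. pd i (g a b) x * h b k x + g a b x * pd i (h b k) x) = 0"
      by (simp add: pd_sum pd_mult pd_const differentiable_g[OF x] differentiable_h[OF x])
    then show ?thesis by (simp add: sum.distrib)
  qed
  have "pd i (h j k) x = (\<Sum>b\<in>UNIV. (\<Sum>a\<in>UNIV. h j a x * g a b x) * pd i (h b k) x)"
    by (simp add: h_g[OF x] if_distrib[of "\<lambda>t. t * _"] cong: if_cong)
  also have "\<dots> = (\<Sum>a\<in>UNIV. h j a x * (\<Sum>b\<in>UNIV. g a b x * pd i (h b k) x))"
    unfolding sum_distrib_left sum_distrib_right
    by (subst sum.swap) (simp add: mult.assoc)
  also have "\<dots> = - (\<Sum>a\<in>UNIV. \<Sum>b\<in>UNIV. h j a x * (L a i b * h b k x))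
      - (\<Sum>a\<in>UNIV. \<Sum>b\<in>UNIV. h j a x * (L b i a * h b k x))"
    by (simp add: dgh dg sum_distrib_left sum.distrib sum_negf sum_subtractf distrib_left distrib_right right_diff_distrib)
  also have "(\<Sum>a\<in>UNIV. \<Sum>b\<in>UNIV. h j a x * (L a i b * h b k x)) = (\<Sum>l\<in>UNIV. \<Gamma> j i l x * h l k x)"
    unfolding \<Gamma> sum_distrib_right by (subst sum.swap) (simp add: mult.assoc)
  also have "(\<Sum>a\<in>UNIV. \<Sum>b\<in>UNIV. h j a x * (L b i a * h b k x)) = (\<Sum>l\<in>UNIV. \<Gamma> k i l x * h j l x)"
    unfolding \<Gamma> sum_distrib_right by (simp add: h_sym[OF x, of k] ac_simps)
  finally show ?thesis .
qed

end

section \<open>Bochner's formula\<close>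

locale riemannian_chart_function = riemannian_chart +
  fixes u :: "'a \<Rightarrow> real"
  assumes C_on_u: "C_on 3 (in_chart c u) U"
begin

abbreviation df :: "'b \<Rightarrow> real^'b \<Rightarrow> real" where
  "df i \<equiv> pd i (in_chart c u)"

text \<open>In index notation \<open>X i\<close> is \<open>X\<^sup>i\<close> for \<open>X = \<nabla>u\<close>, \<open>T i k\<close> is \<open>\<nabla>\<^sub>k X\<^sup>i\<close>, \<open>P\<close> is half the
  differential of \<open>w = |\<nabla>u|\<^sup>2\<close>, and \<open>D j k i\<close> is the \<open>k, i\<close> component of \<open>\<nabla>\<^sub>j T\<close>.\<close>

definition X :: "'b \<Rightarrow> real^'b \<Rightarrow> real" where
  "X i x = (\<Sum>j\<in>UNIV. h i j x * df j x)"

definition H :: "'b \<Rightarrow> 'b \<Rightarrow> real^'b \<Rightarrow> real" where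
  "H i j x = pd i (df j) x - (\<Sum>k\<in>UNIV. \<Gamma> k i j x * df k x)"

definition T :: "'b \<Rightarrow> 'b \<Rightarrow> real^'b \<Rightarrow> real" where
  "T i k x = (\<Sum>j\<in>UNIV. h i j x * H j k x)"

definition w :: "real^'b \<Rightarrow> real" where
  "w x = (\<Sum>k\<in>UNIV. df k x * X k x)"

definition P :: "'b \<Rightarrow> real^'b \<Rightarrow> real" where
  "P i x = (\<Sum>k\<in>UNIV. T k i x * df k x)"

definition D :: "'b \<Rightarrow> 'b \<Rightarrow> 'b \<Rightarrow> real^'b \<Rightarrow> real" where
  "D j k i x = pd j (T k i) x + (\<Sum>l\<in>UNIV. \<Gamma> k j l x * T l i x) - (\<Sum>l\<in>UNIV. \<Gamma> l i j x * T k l x)"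

lemma C_on_df: "C_on 2 (df i) U"
  using C_on_u C_on_pd by (simp add: numeral_2_eq_2 numeral_3_eq_3 del: C_on.simps)

lemma C_on_ddf: "C_on 1 (pd j (df i)) U"
  using C_on_df[of i] C_on_pd by (simp add: numeral_2_eq_2 del: C_on.simps)

lemma C_on_df1: "C_on 1 (df i) U"
  using C_on_df[of i] C_on_SucD[of 1] by (simp add: numeral_2_eq_2 del: C_on.simps)

lemma C_on_X: "C_on 2 (X i) U"
  unfolding X_def[abs_def] by (intro C_on_sum C_on_mult open_U C_on_h C_on_df)

lemma C_on_H: "C_on 1 (H i j) U"
  unfolding H_def[abs_def] by (intro C_on_diff C_on_sum C_on_mult open_U C_on_\<Gamma> C_on_ddf C_on_df1)

lemma C_on_T: "C_on 1 (T i j) U"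
  unfolding T_def[abs_def] by (intro C_on_sum C_on_mult open_U C_on_h C_on_H)

lemma differentiable_df: "x \<in> U \<Longrightarrow> df i differentiable (at x)"
  and differentiable_T: "x \<in> U \<Longrightarrow> T i j differentiable (at x)"
  using C_on_df1 C_on_T C_on_imp_differentiable[of 0] by auto

lemma differentiable_X: "x \<in> U \<Longrightarrow> X i differentiable (at x)"
  using C_on_X[of i] by (simp add: numeral_2_eq_2)

lemma differentiable_pd_X: "x \<in> U \<Longrightarrow> pd j (X i) differentiable (at x)"
  using C_on_pd[of 1 "X i" U j] C_on_X[of i] by (simp add: numeral_2_eq_2)

lemma differentiable_w: "x \<in> U \<Longrightarrow> w differentiable (at x)"
  unfolding w_def[abs_def] by (auto intro!: differentiable_sum differentiable_mult differentiable_df differentiable_X)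

lemma differentiable_P: "x \<in> U \<Longrightarrow> P i differentiable (at x)"
  unfolding P_def[abs_def] by (auto intro!: differentiable_sum differentiable_mult differentiable_df differentiable_T)

lemma differentiable_u: "x \<in> U \<Longrightarrow> in_chart c u differentiable (at x)"
  using C_on_u by (simp add: numeral_3_eq_3)

lemma ddf_sym: "x \<in> U \<Longrightarrow> pd i (df j) x = pd j (df i) x"
  using pd_commute[OF open_U _ C_on_SucD[of 2]] C_on_u by (simp add: numeral_3_eq_3 numeral_2_eq_2)

lemma H_sym: "x \<in> U \<Longrightarrow> H i j x = H j i x"
  unfolding H_def using ddf_sym[of x i j] \<Gamma>_sym[of x _ i j] by simp

lemma P_eq:
  assumes x: "x \<in> U"
  shows "P i x = (\<Sum>j\<in>UNIV. H i j x * X j x)"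
  unfolding P_def T_def X_def sum_distrib_left sum_distrib_right
  by (subst sum.swap) (simp add: h_sym[OF x, of _ j for j] H_sym[OF x, of _ i] ac_simps)

text \<open>Raising an index commutes with covariant differentiation since \<open>h\<close> is
  parallel. Of the two sums in \<open>pd_h\<close>, one is the connection term of \<open>X\<close>
  and the other completes the second derivatives of u to the Hessian.\<close>

lemma pd_X:
  assumes x: "x \<in> U"
  shows "pd k (X i) x = T i k x - (\<Sum>l\<in>UNIV. \<Gamma> i k l x * X l x)"
proof -
  have "pd k (X i) x = (\<Sum>j\<in>UNIV. pd k (h i j) x * df j x) + (\<Sum>j\<in>UNIV. h i j x * pd k (df j) x)"
    unfolding X_def[abs_def]
    by (simp add: pd_sum pd_mult differentiable_h[OF x] differentiable_df[OF x] sum.distrib)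
  also have "(\<Sum>j\<in>UNIV. pd k (h i j) x * df j x) =
      - (\<Sum>j\<in>UNIV. \<Sum>l\<in>UNIV. \<Gamma> i k l x * h l j x * df j x)
      - (\<Sum>j\<in>UNIV. \<Sum>l\<in>UNIV. \<Gamma> j k l x * h i l x * df j x)"
    by (simp add: pd_h[OF x] left_diff_distrib sum_subtractf sum_negf sum_distrib_right)
  also have "(\<Sum>j\<in>UNIV. \<Sum>l\<in>UNIV. \<Gamma> i k l x * h l j x * df j x) = (\<Sum>l\<in>UNIV. \<Gamma> i k l x * X l x)"
    unfolding X_def sum_distrib_left by (subst sum.swap) (simp add: mult.assoc)
  also have "(\<Sum>j\<in>UNIV. \<Sum>l\<in>UNIV. \<Gamma> j k l x * h i l x * df j x)
      = (\<Sum>j\<in>UNIV. \<Sum>l\<in>UNIV. h i j x * (\<Gamma> l j k x * df l x))"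
    by (subst sum.swap) (simp add: \<Gamma>_sym[OF x, of _ k] ac_simps)
  finally show ?thesis
    by (simp add: T_def H_def right_diff_distrib sum_subtractf sum_distrib_left ddf_sym[OF x, of k])
qed

text \<open>Both factors of du(X) contribute the Hessian applied to X, and their connection terms
  have opposite signs.\<close>

lemma pd_w:
  assumes x: "x \<in> U"
  shows "pd i w x = 2 * P i x"
proof -
  have "pd i w x = (\<Sum>k\<in>UNIV. pd i (df k) x * X k x) + (\<Sum>k\<in>UNIV. df k x * pd i (X k) x)"
    unfolding w_def[abs_def]
    by (simp add: pd_sum pd_mult differentiable_X[OF x] differentiable_df[OF x] sum.distrib)
  also have "(\<Sum>k\<in>UNIV. df k x * pd i (X k) x)
      = P i x - (\<Sum>k\<in>UNIV. \<Sum>l\<in>UNIV. df k x * (\<Gamma> k i l x * X l x))"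
    by (simp add: pd_X[OF x] right_diff_distrib sum_subtractf sum_distrib_left P_def mult.commute)
  also have "(\<Sum>k\<in>UNIV. \<Sum>l\<in>UNIV. df k x * (\<Gamma> k i l x * X l x))
      = (\<Sum>l\<in>UNIV. (\<Sum>k\<in>UNIV. \<Gamma> k i l x * df k x) * X l x)"
    unfolding sum_distrib_right by (subst sum.swap) (simp add: ac_simps)
  also have "(\<Sum>k\<in>UNIV. pd i (df k) x * X k x)
      + (P i x - (\<Sum>l\<in>UNIV. (\<Sum>k\<in>UNIV. \<Gamma> k i l x * df k x) * X l x))
      = P i x + (\<Sum>j\<in>UNIV. H i j x * X j x)"
    by (simp add: H_def left_diff_distrib sum_subtractf)
  finally show ?thesis by (simp add: P_eq[OF x, symmetric])
qed

text \<open>The Leibniz rule for the covariant derivative of the contraction \<open>P\<close>: the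
  connection terms of the contracted index cancel, and only that of the free index \<open>i\<close>
  remains on the left.\<close>

lemma pd_P:
  assumes x: "x \<in> U"
  shows "pd j (P i) x - (\<Sum>l\<in>UNIV. \<Gamma> l i j x * P l x)
      = (\<Sum>k\<in>UNIV. D j k i x * df k x) + (\<Sum>k\<in>UNIV. T k i x * H j k x)"
proof -
  have "pd j (P i) x = (\<Sum>k\<in>UNIV. pd j (T k i) x * df k x) + (\<Sum>k\<in>UNIV. T k i x * pd j (df k) x)"
    unfolding P_def[abs_def]
    by (simp add: pd_sum pd_mult differentiable_T[OF x] differentiable_df[OF x] sum.distrib)
  moreover have "(\<Sum>k\<in>UNIV. D j k i x * df k x) = (\<Sum>k\<in>UNIV. pd j (T k i) x * df k x)
      + (\<Sum>k\<in>UNIV. \<Sum>l\<in>UNIV. \<Gamma> k j l x * T l i x * df k x)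
      - (\<Sum>k\<in>UNIV. \<Sum>l\<in>UNIV. \<Gamma> l i j x * T k l x * df k x)"
    by (simp add: D_def algebra_simps sum.distrib sum_subtractf sum_distrib_left)
  moreover have "(\<Sum>k\<in>UNIV. T k i x * H j k x) = (\<Sum>k\<in>UNIV. T k i x * pd j (df k) x)
      - (\<Sum>k\<in>UNIV. \<Sum>l\<in>UNIV. T k i x * (\<Gamma> l j k x * df l x))"
    by (simp add: H_def right_diff_distrib sum_subtractf sum_distrib_left)
  moreover have "(\<Sum>k\<in>UNIV. \<Sum>l\<in>UNIV. \<Gamma> k j l x * T l i x * df k x)
      = (\<Sum>k\<in>UNIV. \<Sum>l\<in>UNIV. T k i x * (\<Gamma> l j k x * df l x))"
    by (subst sum.swap) (simp add: ac_simps)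
  moreover have "(\<Sum>k\<in>UNIV. \<Sum>l\<in>UNIV. \<Gamma> l i j x * T k l x * df k x)
      = (\<Sum>l\<in>UNIV. \<Gamma> l i j x * P l x)"
    unfolding P_def sum_distrib_left by (subst sum.swap) (simp add: mult.assoc)
  ultimately show ?thesis by simp
qed

text \<open>Raising an index turns \<open>D\<close> into the covariant derivative of the symmetric tensor \<open>h H h\<close>.\<close>

lemma contract_D:
  assumes x: "x \<in> U"
  shows "(\<Sum>i\<in>UNIV. \<Sum>j\<in>UNIV. h i j x * D j k i x) = (\<Sum>j\<in>UNIV. \<Sum>i\<in>UNIV. D j j i x * h i k x)"
proof -
  \<comment> \<open>The Hessian with both indices raised. By \<open>dS\<close> below, its covariant
    derivative is \<open>D\<close> with the last index raised, since \<open>h\<close> is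
    parallel.\<close>
  define S where "S k m y = (\<Sum>i\<in>UNIV. T k i y * h i m y)" for k m y
  have S_sym: "S k m y = S m k y" if y: "y \<in> U" for k m y
    unfolding S_def T_def sum_distrib_right
    by (subst sum.swap) (simp add: h_sym[OF y, of m] h_sym[OF y, of _ k] H_sym[OF y, of i for i] ac_simps)
  have dS: "pd j (S k m) x = (\<Sum>i\<in>UNIV. D j k i x * h i m x)
      - (\<Sum>l\<in>UNIV. \<Gamma> k j l x * S l m x) - (\<Sum>l\<in>UNIV. \<Gamma> m j l x * S k l x)" for j k m
  proof -
    have "pd j (S k m) x = (\<Sum>i\<in>UNIV. pd j (T k i) x * h i m x) + (\<Sum>i\<in>UNIV. T k i x * pd j (h i m) x)"
      unfolding S_def[abs_def]
      by (simp add: pd_sum pd_mult differentiable_T[OF x] differentiable_h[OF x] sum.distrib)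
    moreover have "(\<Sum>i\<in>UNIV. T k i x * pd j (h i m) x)
        = - (\<Sum>i\<in>UNIV. \<Sum>l\<in>UNIV. T k i x * (\<Gamma> i j l x * h l m x))
          - (\<Sum>i\<in>UNIV. \<Sum>l\<in>UNIV. T k i x * (\<Gamma> m j l x * h i l x))"
      by (simp add: pd_h[OF x] right_diff_distrib sum_subtractf sum_negf sum_distrib_left)
    moreover have "(\<Sum>i\<in>UNIV. \<Sum>l\<in>UNIV. T k i x * (\<Gamma> m j l x * h i l x))
        = (\<Sum>l\<in>UNIV. \<Gamma> m j l x * S k l x)"
      unfolding S_def sum_distrib_left by (subst sum.swap) (simp add: ac_simps)
    moreover have "(\<Sum>i\<in>UNIV. D j k i x * h i m x) = (\<Sum>i\<in>UNIV. pd j (T k i) x * h i m x)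
        + (\<Sum>i\<in>UNIV. \<Sum>l\<in>UNIV. \<Gamma> k j l x * T l i x * h i m x)
        - (\<Sum>i\<in>UNIV. \<Sum>l\<in>UNIV. \<Gamma> l i j x * T k l x * h i m x)"
      by (simp add: D_def left_diff_distrib distrib_right sum.distrib sum_subtractf sum_distrib_right)
    moreover have "(\<Sum>i\<in>UNIV. \<Sum>l\<in>UNIV. \<Gamma> k j l x * T l i x * h i m x)
        = (\<Sum>l\<in>UNIV. \<Gamma> k j l x * S l m x)"
      unfolding S_def sum_distrib_left by (subst sum.swap) (simp add: ac_simps)
    moreover have "(\<Sum>i\<in>UNIV. \<Sum>l\<in>UNIV. \<Gamma> l i j x * T k l x * h i m x)
        = (\<Sum>i\<in>UNIV. \<Sum>l\<in>UNIV. T k i x * (\<Gamma> i j l x * h l m x))"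
      by (subst sum.swap) (simp add: \<Gamma>_sym[OF x, of _ _ j] ac_simps)
    ultimately show ?thesis by simp
  qed
  have dS_sym: "pd j (S k m) x = pd j (S m k) x" for j k m
    unfolding S_def[abs_def]
    by (rule pd_cong[OF open_U x S_sym[unfolded S_def]])
      (auto intro!: differentiable_sum differentiable_mult differentiable_T[OF x] differentiable_h[OF x])
  \<comment> \<open>Exchanging \<open>k\<close> and \<open>m\<close> exchanges the two connection
    terms of \<open>dS\<close>, so the covariant derivative inherits the symmetry of
    \<open>S\<close>. The contraction then takes \<open>m = j\<close>.\<close>
  have "(\<Sum>i\<in>UNIV. D j k i x * h i m x) = (\<Sum>i\<in>UNIV. D j m i x * h i k x)" for j k m
    using dS[of j k m] dS[of j m k] dS_sym[of j k m] S_sym[OF x, of k] S_sym[OF x, of _ m] by simp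
  then have "(\<Sum>j\<in>UNIV. \<Sum>i\<in>UNIV. D j k i x * h i j x) = (\<Sum>j\<in>UNIV. \<Sum>i\<in>UNIV. D j j i x * h i k x)"
    by simp
  then show ?thesis by (subst sum.swap) (simp add: mult.commute)
qed

text \<open>The Ricci identity for the vector field X. Second partial derivatives of X commute,
  which spends the third derivatives of u, and the term contracting the lower pair \<open>i\<close>,
  \<open>j\<close> drops because the connection is torsion free.\<close>

lemma D_commutator:
  assumes x: "x \<in> U"
  shows "D j k i x - D i k j x = (\<Sum>l\<in>UNIV. riemann M c k l j i x * X l x)"
proof -
  have dT: "pd j (T k i) x = pd j (pd i (X k)) x + (\<Sum>l\<in>UNIV. pd j (\<Gamma> k i l) x * X l x)
      + (\<Sum>l\<in>UNIV. \<Gamma> k i l x * T l j x) - (\<Sum>l\<in>UNIV. \<Sum>m\<in>UNIV. \<Gamma> k i l x * (\<Gamma> l j m x * X m x))" for i j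
  proof -
    \<comment> \<open>Here \<open>T\<close> is read as the covariant derivative of X rather than as
      the raised Hessian, so that second derivatives of X appear.\<close>
    have "pd j (T k i) x = pd j (\<lambda>y. pd i (X k) y + (\<Sum>l\<in>UNIV. \<Gamma> k i l y * X l y)) x"
      by (rule pd_cong[OF open_U x _ differentiable_T[OF x]]) (simp add: pd_X)
    also have "\<dots> = pd j (pd i (X k)) x + (\<Sum>l\<in>UNIV. pd j (\<Gamma> k i l) x * X l x + \<Gamma> k i l x * pd j (X l) x)"
      by (simp add: pd_add pd_sum pd_mult differentiable_pd_X[OF x] differentiable_\<Gamma>[OF x] differentiable_X[OF x])
    finally show ?thesis
      by (simp add: pd_X[OF x] sum.distrib right_diff_distrib sum_subtractf sum_distrib_left)
  qed
  have r: "(\<Sum>l\<in>UNIV. riemann M c k l j i x * X l x)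
      = (\<Sum>l\<in>UNIV. pd j (\<Gamma> k i l) x * X l x) - (\<Sum>l\<in>UNIV. pd i (\<Gamma> k j l) x * X l x)
        + (\<Sum>l\<in>UNIV. \<Sum>q\<in>UNIV. \<Gamma> k j q x * \<Gamma> q i l x * X l x)
        - (\<Sum>l\<in>UNIV. \<Sum>q\<in>UNIV. \<Gamma> k i q x * \<Gamma> q j l x * X l x)"
    by (simp add: riemann_def sum.distrib sum_subtractf left_diff_distrib distrib_right sum_distrib_right)
  have s: "(\<Sum>l\<in>UNIV. \<Sum>q\<in>UNIV. \<Gamma> k i q x * \<Gamma> q j l x * X l x)
      = (\<Sum>l\<in>UNIV. \<Sum>m\<in>UNIV. \<Gamma> k i l x * (\<Gamma> l j m x * X m x))" for i j
    by (subst sum.swap) (simp add: mult.assoc)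
  have "pd j (pd i (X k)) x = pd i (pd j (X k)) x"
    by (rule pd_commute[OF open_U x C_on_X])
  then show ?thesis
    unfolding r s D_def dT using \<Gamma>_sym[OF x, of _ i j] by simp
qed

lemma laplacian_eq: "x \<in> U \<Longrightarrow> laplacian M c u x = (\<Sum>i\<in>UNIV. T i i x)"
  unfolding laplacian_def T_def hessian_def H_def[symmetric] by (simp add: H_sym H_def[symmetric])

text \<open>The left side is half the Laplacian of w, because P is half of dw.
  \<open>contract_D\<close> moves the divergence onto the other Hessian index, commuting the two
  derivatives costs the Ricci term, and what remains is the gradient of the trace. The last sum is
  the squared norm of the Hessian.\<close>

lemma bochner:
  assumes x: "x \<in> U"
  shows "(\<Sum>i\<in>UNIV. \<Sum>j\<in>UNIV. h i j x * (pd j (P i) x - (\<Sum>l\<in>UNIV. \<Gamma> l i j x * P l x)))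
    = (\<Sum>i\<in>UNIV. X i x * pd i (\<lambda>y. \<Sum>j\<in>UNIV. T j j y) x)
      + (\<Sum>i\<in>UNIV. \<Sum>l\<in>UNIV. ricci M c x $ i $ l * X i x * X l x)
      + (\<Sum>i\<in>UNIV. \<Sum>k\<in>UNIV. T i k x * T k i x)"
proof -
  \<comment> \<open>The trace commutes with covariant differentiation.\<close>
  have tr: "(\<Sum>j\<in>UNIV. D i j j x) = pd i (\<lambda>y. \<Sum>j\<in>UNIV. T j j y) x" for i
  proof -
    have "(\<Sum>j\<in>UNIV. \<Sum>l\<in>UNIV. \<Gamma> j i l x * T l j x) = (\<Sum>j\<in>UNIV. \<Sum>l\<in>UNIV. \<Gamma> l j i x * T j l x)"
      by (subst sum.swap) (simp add: \<Gamma>_sym[OF x, of _ i])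
    then show ?thesis
      by (simp add: D_def sum_subtractf sum.distrib pd_sum differentiable_T[OF x])
  qed
  have "(\<Sum>i\<in>UNIV. \<Sum>j\<in>UNIV. h i j x * (pd j (P i) x - (\<Sum>l\<in>UNIV. \<Gamma> l i j x * P l x)))
    = (\<Sum>i\<in>UNIV. \<Sum>j\<in>UNIV. \<Sum>k\<in>UNIV. h i j x * D j k i x * df k x)
      + (\<Sum>i\<in>UNIV. \<Sum>j\<in>UNIV. \<Sum>k\<in>UNIV. h i j x * (T k i x * H j k x))"
    by (simp add: pd_P[OF x] distrib_left sum.distrib sum_distrib_left mult.assoc)
  also have "(\<Sum>i\<in>UNIV. \<Sum>j\<in>UNIV. \<Sum>k\<in>UNIV. h i j x * (T k i x * H j k x))
      = (\<Sum>i\<in>UNIV. \<Sum>k\<in>UNIV. T i k x * T k i x)"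
  proof (rule sum.cong[OF refl])
    fix i
    have "T i k x * T k i x = (\<Sum>j\<in>UNIV. h i j x * (T k i x * H j k x))" for k
      unfolding T_def[of i k] sum_distrib_right by (simp add: ac_simps)
    then show "(\<Sum>j\<in>UNIV. \<Sum>k\<in>UNIV. h i j x * (T k i x * H j k x)) = (\<Sum>k\<in>UNIV. T i k x * T k i x)"
      by (subst sum.swap) simp
  qed
  also have "(\<Sum>i\<in>UNIV. \<Sum>j\<in>UNIV. \<Sum>k\<in>UNIV. h i j x * D j k i x * df k x)
      = (\<Sum>k\<in>UNIV. (\<Sum>i\<in>UNIV. \<Sum>j\<in>UNIV. h i j x * D j k i x) * df k x)"
  proof -
    have "(\<Sum>i\<in>UNIV. \<Sum>j\<in>UNIV. \<Sum>k\<in>UNIV. h i j x * D j k i x * df k x)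
        = (\<Sum>i\<in>UNIV. \<Sum>k\<in>UNIV. \<Sum>j\<in>UNIV. h i j x * D j k i x * df k x)"
      by (intro sum.cong refl sum.swap)
    also have "\<dots> = (\<Sum>k\<in>UNIV. \<Sum>i\<in>UNIV. \<Sum>j\<in>UNIV. h i j x * D j k i x * df k x)"
      by (rule sum.swap)
    finally show ?thesis by (simp add: sum_distrib_right)
  qed
  also have "\<dots> = (\<Sum>k\<in>UNIV. \<Sum>j\<in>UNIV. \<Sum>i\<in>UNIV. D j j i x * h i k x * df k x)"
    unfolding contract_D[OF x] sum_distrib_right ..
  also have "\<dots> = (\<Sum>j\<in>UNIV. \<Sum>k\<in>UNIV. \<Sum>i\<in>UNIV. D j j i x * h i k x * df k x)"
    by (rule sum.swap)
  also have "\<dots> = (\<Sum>j\<in>UNIV. \<Sum>i\<in>UNIV. \<Sum>k\<in>UNIV. D j j i x * h i k x * df k x)"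
    by (intro sum.cong refl sum.swap)
  also have "\<dots> = (\<Sum>j\<in>UNIV. \<Sum>i\<in>UNIV. D j j i x * X i x)"
    by (simp add: X_def sum_distrib_left mult.assoc)
  also have "\<dots> = (\<Sum>i\<in>UNIV. X i x * (\<Sum>j\<in>UNIV. D j j i x))"
    by (subst sum.swap) (simp add: sum_distrib_left mult.commute)
  also have "\<dots> = (\<Sum>i\<in>UNIV. X i x * (\<Sum>j\<in>UNIV. D i j j x))
      + (\<Sum>i\<in>UNIV. \<Sum>l\<in>UNIV. ricci M c x $ i $ l * X i x * X l x)"
  proof -
    have "(\<Sum>j\<in>UNIV. D j j i x) = (\<Sum>j\<in>UNIV. D i j j x) + (\<Sum>l\<in>UNIV. ricci M c x $ i $ l * X l x)" for i
    proof -
      have "(\<Sum>j\<in>UNIV. D j j i x) - (\<Sum>j\<in>UNIV. D i j j x)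
          = (\<Sum>j\<in>UNIV. \<Sum>l\<in>UNIV. riemann M c j l j i x * X l x)"
        by (simp add: sum_subtractf[symmetric] D_commutator[OF x])
      also have "\<dots> = (\<Sum>l\<in>UNIV. ricci M c x $ i $ l * X l x)"
        by (subst sum.swap) (simp add: ricci_def sum_distrib_right)
      finally show ?thesis by simp
    qed
    then show ?thesis
      by (simp add: distrib_left sum.distrib sum_distrib_left ac_simps)
  qed
  finally show ?thesis unfolding tr .
qed

section \<open>Inequality at an interior maximum\<close>

text \<open>\<open>L\<close> is the Laplacian of u by \<open>laplacian_eq\<close>, and
  \<open>Q\<close> is the Hessian evaluated twice on \<nabla>u. In this form both are visibly built
  from differentiable functions.\<close>

abbreviation L :: "real^'b \<Rightarrow> real" where
  "L y \<equiv> \<Sum>j\<in>UNIV. T j j y"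

abbreviation Q :: "real^'b \<Rightarrow> real" where
  "Q y \<equiv> \<Sum>i\<in>UNIV. X i y * P i y"

text \<open>\<open>V K\<close> is half the differential of \<open>exp (2Ku) w\<close>, divided by \<open>exp (2Ku)\<close>.\<close>

abbreviation V :: "real \<Rightarrow> 'b \<Rightarrow> real^'b \<Rightarrow> real" where
  "V K i y \<equiv> K * df i y * w y + P i y"

lemma sum_h_df_df: "qform (\<lambda>i j. h i j x) (\<lambda>i. df i x) (\<lambda>i. df i x) = w x"
  unfolding w_def X_def sum_distrib_left by (simp add: ac_simps)

lemma sum_X: "x \<in> U \<Longrightarrow> (\<Sum>i\<in>UNIV. X i x * v i) = qform (\<lambda>i j. h i j x) (\<lambda>i. df i x) v"
  unfolding X_def sum_distrib_right by (subst sum.swap) (simp add: h_sym ac_simps)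

lemma differentiable_V: "x \<in> U \<Longrightarrow> V K i differentiable (at x)"
  by (intro differentiable_add differentiable_mult differentiable_const differentiable_df
      differentiable_w differentiable_P)

text \<open>Along a line the first derivative is a positive factor times \<open>V K\<close> applied
  to the direction. Once \<open>V K\<close> vanishes, the derivative of the factor drops out of the
  second derivative, leaving a positive multiple of the form of \<open>pd j (V K i)\<close>.\<close>

lemma interior_max_necessary:
  assumes x0: "x0 \<in> U"
    and max: "\<forall>\<^sub>F x in nhds x0. exp (2 * K * in_chart c u x) * w x \<le> exp (2 * K * in_chart c u x0) * w x0"
  shows "V K i x0 = 0" "qform (\<lambda>i j. pd j (V K i) x0) v v \<le> 0"
proof -
  obtain S where S: "open S" "x0 \<in> S" "\<And>x. x \<in> S \<Longrightarrow>
      exp (2 * K * in_chart c u x) * w x \<le> exp (2 * K * in_chart c u x0) * w x0"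
    using max unfolding eventually_nhds by blast
  obtain r where r: "r > 0" "ball x0 r \<subseteq> S \<inter> U"
    using openE[of "S \<inter> U" x0] S x0 open_U by blast
  have along: "(\<Sum>i\<in>UNIV. v $ i * V K i x0) = 0
      \<and> (\<Sum>i\<in>UNIV. v $ i * (\<Sum>j\<in>UNIV. v $ j * pd j (V K i) x0)) \<le> 0" for v
  proof -
    \<comment> \<open>Keeps the segment in the ball; the summand 1 covers
      \<open>v = 0\<close>.\<close>
    define d where "d = r / (norm v + 1)"
    have nv: "norm v + 1 > 0" by (simp add: add_nonneg_pos)
    have d: "d > 0" using r nv by (simp add: d_def)
    have line: "x0 + t *\<^sub>R v \<in> S \<inter> U" if "\<bar>t\<bar> < d" for t
    proof -
      have "\<bar>t\<bar> * norm v \<le> \<bar>t\<bar> * (norm v + 1)" by (intro mult_left_mono) auto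
      also have "\<dots> < r" using that nv by (simp add: d_def pos_less_divide_eq)
      finally show ?thesis using r(2) by (auto simp: dist_norm)
    qed
    define e where "e t = 2 * exp (2 * K * in_chart c u (x0 + t *\<^sub>R v))" for t
    define \<sigma> where "\<sigma> t = (\<Sum>i\<in>UNIV. v $ i * V K i (x0 + t *\<^sub>R v))" for t
    have du: "((\<lambda>t. in_chart c u (x0 + t *\<^sub>R v)) has_real_derivative
        (\<Sum>i\<in>UNIV. v $ i * df i (x0 + t *\<^sub>R v))) (at t)" if "\<bar>t\<bar> < d" for t
      using has_real_derivative_along_line[OF differentiable_u, of x0 t v] line[OF that]
      by (simp add: frechet_derivative_eq_sum_pd[OF differentiable_u])
    have dw: "((\<lambda>t. w (x0 + t *\<^sub>R v)) has_real_derivative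
        (\<Sum>i\<in>UNIV. v $ i * (2 * P i (x0 + t *\<^sub>R v)))) (at t)" if "\<bar>t\<bar> < d" for t
      using has_real_derivative_along_line[OF differentiable_w, of x0 t v] line[OF that]
      by (simp add: frechet_derivative_eq_sum_pd[OF differentiable_w] pd_w)
    have d1: "((\<lambda>t. exp (2 * K * in_chart c u (x0 + t *\<^sub>R v)) * w (x0 + t *\<^sub>R v))
        has_real_derivative e t * \<sigma> t) (at t)" if "\<bar>t\<bar> < d" for t
      by (rule derivative_eq_intros du[OF that] dw[OF that] refl)+
        (simp add: e_def \<sigma>_def sum_distrib_left sum_distrib_right sum.distrib[symmetric] algebra_simps)
    have d\<sigma>: "(\<sigma> has_real_derivative (\<Sum>i\<in>UNIV. v $ i * (\<Sum>j\<in>UNIV. v $ j * pd j (V K i) x0))) (at 0)"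
    proof -
      have "((\<lambda>t. V K i (x0 + t *\<^sub>R v)) has_real_derivative (\<Sum>j\<in>UNIV. v $ j * pd j (V K i) x0)) (at 0)" for i
        using has_real_derivative_along_line[OF differentiable_V, of x0 0 v] x0
        by (simp add: frechet_derivative_eq_sum_pd[OF differentiable_V[OF x0]])
      then show ?thesis unfolding \<sigma>_def[abs_def]
        by (intro DERIV_sum DERIV_cmult) auto
    qed
    have de: "(e has_real_derivative 2 * (e 0 * K * (\<Sum>i\<in>UNIV. v $ i * df i x0))) (at 0)"
      unfolding e_def[abs_def]
      by (rule derivative_eq_intros du[of 0] d refl)+ (use d in auto)
    note d2 = DERIV_mult[OF de d\<sigma>]
    have mx: "exp (2 * K * in_chart c u (x0 + t *\<^sub>R v)) * w (x0 + t *\<^sub>R v)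
        \<le> exp (2 * K * in_chart c u (x0 + 0 *\<^sub>R v)) * w (x0 + 0 *\<^sub>R v)" if "\<bar>t\<bar> < d" for t
      using S(3) line[OF that] by simp
    note res = local_max_derivatives[OF d d1 d2 mx]
    have e0: "e 0 > 0" by (simp add: e_def)
    have \<sigma>0: "\<sigma> 0 = 0" using res(1) e0 by simp
    have "(\<Sum>i\<in>UNIV. v $ i * (\<Sum>j\<in>UNIV. v $ j * pd j (V K i) x0)) \<le> 0"
      using res(2) e0 \<sigma>0 by (simp add: zero_less_mult_iff mult_le_0_iff)
    then show ?thesis using \<sigma>0 by (simp add: \<sigma>_def)
  qed
  show "V K i x0 = 0"
    using along[of "axis i 1"] by (simp add: axis_def if_distrib[of "\<lambda>t. t * _"] cong: if_cong)
  show "qform (\<lambda>i j. pd j (V K i) x0) v v \<le> 0"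
    using along[of "\<chi> i. v i"] by (simp add: sum_distrib_left algebra_simps)
qed

lemma interior_max_inequality:
  assumes x0: "x0 \<in> U" and pos: "w x0 > 0"
    and max: "\<forall>\<^sub>F x in nhds x0. exp (2 * K * in_chart c u x) * w x \<le> exp (2 * K * in_chart c u x0) * w x0"
    and eq: "\<And>x. x \<in> U \<Longrightarrow> w x * L x + b (sqrt (w x)) * Q x = 0"
    and b': "(b has_real_derivative b') (at (sqrt (w x0)))" and b: "b (sqrt (w x0)) > - 1"
  shows "qform (\<lambda>i j. ricci M c x0 $ i $ j) (\<lambda>i. X i x0) (\<lambda>i. X i x0)
    + K\<^sup>2 * (w x0)\<^sup>2 * (- b' * sqrt (w x0) - (b (sqrt (w x0)) + 1)) \<le> 0"
proof -
  define s where "s = sqrt (w x0)"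
  define W where "W = w x0"
  define B where "B = b s"
  have W: "W > 0" and s: "s > 0" "s\<^sup>2 = W" using pos by (auto simp: s_def W_def)
  define N where "N i j = pd j (V K i) x0" for i j
  \<comment> \<open>Criticality makes du an eigencovector of the Hessian with eigenvalue
    \<open>- K * W\<close>. This fixes \<open>Q\<close> at \<open>x0\<close>, and the equation then
    fixes \<open>L\<close>.\<close>
  have P0: "P i x0 = - K * W * df i x0" for i
    using interior_max_necessary(1)[OF x0 max, of i] unfolding W_def by (simp add: algebra_simps)
  have nsd: "qform N v v \<le> 0" for v
    unfolding N_def by (rule interior_max_necessary(2)[OF x0 max])
  have XP: "(\<Sum>i\<in>UNIV. X i x0 * df i x0) = W" by (simp add: W_def w_def mult.commute)
  have Q0: "Q x0 = - K * W\<^sup>2"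
    using XP by (simp add: P0 power2_eq_square sum_distrib_left[symmetric] mult.left_commute mult.assoc)
      (simp add: sum_negf sum_distrib_left[symmetric])
  have L0: "L x0 = B * K * W"
    using eq[OF x0] pos unfolding Q0 unfolding B_def s_def W_def
    by (simp add: power2_eq_square)
  define XL where "XL = (\<Sum>i\<in>UNIV. X i x0 * pd i L x0)"
  define XQ where "XQ = (\<Sum>i\<in>UNIV. X i x0 * pd i Q x0)"
  define Ric where "Ric = qform (\<lambda>i j. ricci M c x0 $ i $ j) (\<lambda>i. X i x0) (\<lambda>i. X i x0)"
  define tr where "tr = (\<Sum>i\<in>UNIV. \<Sum>k\<in>UNIV. T i k x0 * T k i x0)"
  have N: "N i j = K * W * pd j (df i) x0 + 2 * K * df i x0 * P j x0 + pd j (P i) x0" for i j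
    unfolding N_def W_def
    by (simp add: pd_add pd_mult pd_const pd_w[OF x0] differentiable_w[OF x0] differentiable_P[OF x0]
        differentiable_df[OF x0] algebra_simps)
  have trace_h: "(\<Sum>i\<in>UNIV. \<Sum>j\<in>UNIV. h i j x0 * N i j)
      = K * W * L x0 - 2 * K\<^sup>2 * W\<^sup>2 + (XL + Ric + tr)"
  proof -
    \<comment> \<open>Since P is a multiple of du at \<open>x0\<close>, the Christoffel terms needed
      to complete the second derivatives of u and the derivative of P cancel.\<close>
    have Nij: "N i j = K * W * H j i x0 - 2 * K\<^sup>2 * W * (df i x0 * df j x0)
        + (pd j (P i) x0 - (\<Sum>l\<in>UNIV. \<Gamma> l i j x0 * P l x0))" for i j
    proof -
      have "(\<Sum>l\<in>UNIV. \<Gamma> l i j x0 * P l x0) = - K * W * (\<Sum>l\<in>UNIV. \<Gamma> l j i x0 * df l x0)"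
        by (simp add: P0 \<Gamma>_sym[OF x0, of _ j] sum_distrib_left sum_negf ac_simps)
      then show ?thesis unfolding N H_def by (simp add: P0 power2_eq_square algebra_simps)
    qed
    have "(\<Sum>i\<in>UNIV. \<Sum>j\<in>UNIV. h i j x0 * N i j)
        = K * W * (\<Sum>i\<in>UNIV. \<Sum>j\<in>UNIV. h i j x0 * H j i x0)
          - 2 * K\<^sup>2 * W * qform (\<lambda>i j. h i j x0) (\<lambda>i. df i x0) (\<lambda>i. df i x0)
          + (\<Sum>i\<in>UNIV. \<Sum>j\<in>UNIV. h i j x0 * (pd j (P i) x0 - (\<Sum>l\<in>UNIV. \<Gamma> l i j x0 * P l x0)))"
      unfolding Nij distrib_left right_diff_distrib sum.distrib sum_subtractf sum_distrib_left
      by (simp add: ac_simps)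
    then show ?thesis
      unfolding bochner[OF x0] sum_h_df_df XL_def Ric_def tr_def
      by (simp add: T_def W_def[symmetric] power2_eq_square)
  qed
  have trace_X: "(\<Sum>i\<in>UNIV. \<Sum>j\<in>UNIV. X i x0 * X j x0 * N i j) = XQ - 4 * K\<^sup>2 * W ^ 3"
  proof -
    \<comment> \<open>Differentiating w and Q both produces the sum of du times the derivatives of
      X, with coefficients that cancel by \<open>P0\<close>. The 4 is 2 from the derivative of w and
      2 from the middle term of \<open>N\<close>.\<close>
    have XN: "(\<Sum>i\<in>UNIV. X i x0 * N i j) = pd j Q x0 - 4 * K\<^sup>2 * W\<^sup>2 * df j x0" for j
    proof -
      have dQ: "pd j Q x0 = (\<Sum>i\<in>UNIV. pd j (X i) x0 * P i x0) + (\<Sum>i\<in>UNIV. X i x0 * pd j (P i) x0)"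
        by (simp add: pd_sum pd_mult differentiable_X[OF x0] differentiable_P[OF x0] sum.distrib)
      have dw: "2 * P j x0 = (\<Sum>i\<in>UNIV. pd j (df i) x0 * X i x0) + (\<Sum>i\<in>UNIV. df i x0 * pd j (X i) x0)"
        unfolding pd_w[OF x0, symmetric] w_def[abs_def]
        by (simp add: pd_sum pd_mult differentiable_X[OF x0] differentiable_df[OF x0] sum.distrib)
      have 1: "(\<Sum>i\<in>UNIV. pd j (X i) x0 * P i x0) = - K * W * (\<Sum>i\<in>UNIV. df i x0 * pd j (X i) x0)"
        by (simp add: P0 sum_distrib_left sum_negf ac_simps)
      have "(\<Sum>i\<in>UNIV. X i x0 * N i j) = K * W * (\<Sum>i\<in>UNIV. pd j (df i) x0 * X i x0)
          + 2 * K * P j x0 * (\<Sum>i\<in>UNIV. X i x0 * df i x0) + (\<Sum>i\<in>UNIV. X i x0 * pd j (P i) x0)"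
        unfolding N distrib_left sum.distrib sum_distrib_left by (simp add: ac_simps)
      also have "(\<Sum>i\<in>UNIV. pd j (df i) x0 * X i x0) = 2 * P j x0 - (\<Sum>i\<in>UNIV. df i x0 * pd j (X i) x0)"
        using dw by simp
      also have "(\<Sum>i\<in>UNIV. X i x0 * pd j (P i) x0)
          = pd j Q x0 + K * W * (\<Sum>i\<in>UNIV. df i x0 * pd j (X i) x0)"
        using dQ 1 by simp
      finally show ?thesis unfolding XP by (simp add: P0 power2_eq_square algebra_simps)
    qed
    have "(\<Sum>i\<in>UNIV. \<Sum>j\<in>UNIV. X i x0 * X j x0 * N i j)
        = (\<Sum>j\<in>UNIV. X j x0 * (\<Sum>i\<in>UNIV. X i x0 * N i j))"
      unfolding sum_distrib_left by (subst sum.swap) (simp add: ac_simps)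
    also have "\<dots> = XQ - 4 * K\<^sup>2 * W\<^sup>2 * (\<Sum>j\<in>UNIV. X j x0 * df j x0)"
      unfolding XN XQ_def right_diff_distrib sum_subtractf sum_distrib_left by (simp add: ac_simps)
    finally show ?thesis unfolding XP by (simp add: power2_eq_square power3_eq_cube algebra_simps)
  qed
  \<comment> \<open>The equation differentiated along X at \<open>x0\<close>, with the values
    \<open>L0\<close> and \<open>Q0\<close> inserted. The factor \<open>b' / s\<close> arises
    because the derivative of \<open>sqrt w\<close> is \<open>P j / s\<close>.\<close>
  have equation': "- 2 * B * K\<^sup>2 * W ^ 3 + W * XL + b' / s * K\<^sup>2 * W ^ 4 + B * XQ = 0"
  proof -
    have "2 * P j x0 * L x0 + W * pd j L x0 + b' / s * P j x0 * Q x0 + B * pd j Q x0 = 0" for j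
    proof -
      have dw: "(w has_derivative frechet_derivative w (at x0)) (at x0)"
        using differentiable_w[OF x0] by (simp add: frechet_derivative_works)
      have "((\<lambda>y. sqrt (w y)) has_derivative (\<lambda>v. frechet_derivative w (at x0) v * (inverse s / 2))) (at x0)"
        using dw pos unfolding s_def by (auto intro!: derivative_eq_intros)
      from has_derivative_compose[OF this b'[unfolded has_field_derivative_def]]
      have db: "((\<lambda>y. b (sqrt (w y))) has_derivative
          (\<lambda>v. b' * (frechet_derivative w (at x0) v * (inverse s / 2)))) (at x0)" .
      then have bdiff: "(\<lambda>y. b (sqrt (w y))) differentiable (at x0)"
        by (auto simp: differentiable_def)
      have "pd j (\<lambda>y. b (sqrt (w y))) x0 = b' * (pd j w x0 * (inverse s / 2))"
        unfolding pd_def frechet_derivative_at[OF db, symmetric] ..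
      then have pb: "pd j (\<lambda>y. b (sqrt (w y))) x0 = b' / s * P j x0"
        unfolding pd_w[OF x0] using s(1) by (simp add: field_simps)
      have Ld: "L differentiable (at x0)" and Qd: "Q differentiable (at x0)"
        by (auto intro!: differentiable_sum differentiable_mult differentiable_T[OF x0]
            differentiable_X[OF x0] differentiable_P[OF x0])
      have "pd j (\<lambda>y. w y * L y + b (sqrt (w y)) * Q y) x0 = pd j (\<lambda>y. 0) x0"
        using eq by (intro pd_cong[OF open_U x0] differentiable_add differentiable_mult
            differentiable_w[OF x0] bdiff Ld Qd) auto
      moreover have "pd j (\<lambda>y. w y * L y + b (sqrt (w y)) * Q y) x0
          = pd j w x0 * L x0 + w x0 * pd j L x0
            + (pd j (\<lambda>y. b (sqrt (w y))) x0 * Q x0 + b (sqrt (w x0)) * pd j Q x0)"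
        by (simp only: pd_add[OF differentiable_mult[OF differentiable_w[OF x0] Ld] differentiable_mult[OF bdiff Qd]]
            pd_mult[OF differentiable_w[OF x0] Ld] pd_mult[OF bdiff Qd])
      ultimately show ?thesis
        unfolding pb pd_const pd_w[OF x0] by (simp add: W_def B_def s_def)
    qed
    then have "0 = (\<Sum>j\<in>UNIV. X j x0 * (2 * P j x0 * L x0 + W * pd j L x0 + b' / s * P j x0 * Q x0 + B * pd j Q x0))"
      by simp
    also have "\<dots> = 2 * L x0 * Q x0 + W * XL + b' / s * Q x0 * Q x0 + B * XQ"
    proof -
      define l q where "l = L x0" and "q = Q x0"
      have q: "q = (\<Sum>j\<in>UNIV. X j x0 * P j x0)" by (simp add: q_def)
      have "(\<Sum>j\<in>UNIV. X j x0 * (2 * P j x0 * l + W * pd j L x0 + b' / s * P j x0 * q + B * pd j Q x0))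
          = 2 * l * (\<Sum>j\<in>UNIV. X j x0 * P j x0) + W * XL + b' / s * q * (\<Sum>j\<in>UNIV. X j x0 * P j x0) + B * XQ"
        unfolding XL_def XQ_def sum_distrib_left distrib_left sum.distrib by (simp add: ac_simps)
      then show ?thesis unfolding q[symmetric] unfolding l_def q_def .
    qed
    finally show ?thesis unfolding L0 Q0
      by (simp add: power2_eq_square power3_eq_cube power4_eq_xxxx algebra_simps)
  qed
  have cs: "(\<Sum>i\<in>UNIV. X i x0 * v i)\<^sup>2 \<le> W * qform (\<lambda>i j. h i j x0) v v" for v
    unfolding sum_X[OF x0] W_def sum_h_df_df[symmetric]
    by (rule qform_Cauchy_Schwarz[OF h_sym[OF x0] h_quadratic_nonneg[OF x0]])
  \<comment> \<open>\<open>W * A\<close> is the coefficient matrix of the equation at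
    \<open>x0\<close>.\<close>
  define A where "A i j = h i j x0 + B / W * (X i x0 * X j x0)" for i j
  \<comment> \<open>The part \<open>y\<close> of the form along X is at most the whole
    \<open>q\<close>, so \<open>B > -1\<close> suffices.\<close>
  have A_psd: "0 \<le> qform A v v" for v
  proof -
    define q y where "q = qform (\<lambda>i j. h i j x0) v v" and "y = (\<Sum>i\<in>UNIV. X i x0 * v i)\<^sup>2 / W"
    have "qform A v v = q + B * y"
      unfolding A_def q_def y_def power2_eq_square sum_product
      by (simp add: distrib_left sum.distrib sum_distrib_left sum_divide_distrib ac_simps)
    moreover have "0 \<le> y" "y \<le> q"
      using cs[of v] W by (auto simp: y_def q_def pos_divide_le_eq mult.commute)
    moreover have "B > -1" using b by (simp add: B_def s_def)
    ultimately show ?thesis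
      using mult_right_mono[of "-1" B y] by simp
  qed
  have "(\<Sum>i\<in>UNIV. \<Sum>j\<in>UNIV. A i j * N i j) \<le> 0"
    by (rule sum_mult_psd_nsd_nonpos[OF _ A_psd nsd]) (simp add: A_def h_sym[OF x0] mult.commute)
  moreover have "(\<Sum>i\<in>UNIV. \<Sum>j\<in>UNIV. A i j * N i j) = (\<Sum>i\<in>UNIV. \<Sum>j\<in>UNIV. h i j x0 * N i j)
      + B / W * (\<Sum>i\<in>UNIV. \<Sum>j\<in>UNIV. X i x0 * X j x0 * N i j)"
    unfolding A_def distrib_right sum.distrib sum_distrib_left by (simp add: mult.assoc)
  ultimately have le: "K * W * (B * K * W) - 2 * K\<^sup>2 * W\<^sup>2 + (XL + Ric + tr)
      + B / W * (XQ - 4 * K\<^sup>2 * W ^ 3) \<le> 0"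
    unfolding trace_h trace_X L0 by simp
  have tr: "K\<^sup>2 * W\<^sup>2 \<le> tr"
  proof -
    have "(- K * W)\<^sup>2 \<le> tr"
      unfolding tr_def
    proof (rule trace_square_ge_eigenvalue_square[OF h_sym[OF x0] h_quadratic_nonneg[OF x0] H_sym[OF x0] T_def])
      show "0 < qform (\<lambda>i j. h i j x0) (\<lambda>i. df i x0) (\<lambda>i. df i x0)" by (simp add: sum_h_df_df pos)
      show "(\<Sum>i\<in>UNIV. T i k x0 * df i x0) = - K * W * df k x0" for k
        unfolding P0[symmetric] P_def ..
    qed
    then show ?thesis by (simp add: power_mult_distrib)
  qed
  \<comment> \<open>The only combination of third derivatives left in \<open>le\<close>.\<close>
  have XLQ: "XL + B / W * XQ = 2 * B * K\<^sup>2 * W\<^sup>2 - b' * s * K\<^sup>2 * W\<^sup>2"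
  proof -
    have "b' / s * K\<^sup>2 * W ^ 4 = b' * s * K\<^sup>2 * W ^ 3"
      using s by (simp add: s(2)[symmetric] power2_eq_square eval_nat_numeral)
    then have "W * XL + B * XQ = W * (2 * B * K\<^sup>2 * W\<^sup>2 - b' * s * K\<^sup>2 * W\<^sup>2)"
      using equation' by (simp add: power2_eq_square power3_eq_cube algebra_simps)
    then have "XL = (2 * B * K\<^sup>2 * W\<^sup>2 - b' * s * K\<^sup>2 * W\<^sup>2) - B * XQ / W"
      using W by (simp add: field_simps)
    then show ?thesis by simp
  qed
  \<comment> \<open>Collecting multiples of \<open>K\<^sup>2 * W\<^sup>2\<close>:
    \<open>B - 2 - 4 * B\<close> here, \<open>2 * B\<close> from \<open>XLQ\<close> and at least 1
    from \<open>tr\<close>, hence \<open>- (B + 1)\<close>.\<close>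
  have "K * W * (B * K * W) - 2 * K\<^sup>2 * W\<^sup>2 + (XL + Ric + tr) + B / W * (XQ - 4 * K\<^sup>2 * W ^ 3)
      = (XL + B / W * XQ) + Ric + tr + K\<^sup>2 * W\<^sup>2 * (B - 2 - 4 * B)"
    using W by (simp add: power2_eq_square power3_eq_cube field_simps)
  then have "Ric + K\<^sup>2 * W\<^sup>2 * (- b' * s - (B + 1)) \<le> 0"
    using le tr unfolding XLQ by (simp add: algebra_simps)
  then show ?thesis unfolding Ric_def W_def B_def s_def .
qed

end

section \<open>Charts of a Riemannian manifold\<close>

lemma coords_in_image [simp]: "p \<in> dom_chart c \<Longrightarrow> p \<in> \<Omega> \<Longrightarrow> coords c p \<in> coords c ` (\<Omega> \<inter> dom_chart c)"
  by blast

lemma chart_homeomorphism: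
  assumes "riemannian_manifold M" "c \<in> atlas M"
  shows "open (dom_chart c)" "open (coords c ` dom_chart c)"
    "homeomorphism (dom_chart c) (coords c ` dom_chart c) (coords c) (uncoords c)"
  using assms by (auto simp: riemannian_manifold_def smooth_atlas_def)

lemma uncoords_coords:
  assumes "riemannian_manifold M" "c \<in> atlas M" "p \<in> dom_chart c"
  shows "uncoords c (coords c p) = p"
  using chart_homeomorphism(3)[OF assms(1,2)] assms(3) by (simp add: homeomorphism_def)

lemma open_chart_image:
  assumes "riemannian_manifold M" "c \<in> atlas M" "open \<Omega>"
  shows "open (coords c ` (\<Omega> \<inter> dom_chart c))"
proof -
  have "openin (top_of_set (coords c ` dom_chart c)) (coords c ` (\<Omega> \<inter> dom_chart c))"
    using homeomorphism_imp_open_map[OF chart_homeomorphism(3)[OF assms(1,2)], of "\<Omega> \<inter> dom_chart c"]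
      assms(3) by (metis Int_commute openin_open_Int)
  then show ?thesis using chart_homeomorphism(2)[OF assms(1,2)] openin_open_trans by blast
qed

lemma gram_coords:
  assumes "riemannian_manifold M" "c \<in> atlas M" "p \<in> dom_chart c"
  shows "gram M c (coords c p) = metric M c p"
  by (simp add: gram_def in_chart_def uncoords_coords[OF assms])

lemma chart_atI:
  assumes "riemannian_manifold M"
  shows "chart_at M p \<in> atlas M" "p \<in> dom_chart (chart_at M p)"
proof -
  have "\<exists>c. c \<in> atlas M \<and> p \<in> dom_chart c"
    using assms unfolding riemannian_manifold_def smooth_atlas_def by blast
  from someI_ex[OF this] show "chart_at M p \<in> atlas M" "p \<in> dom_chart (chart_at M p)"
    unfolding chart_at_def by auto
qed

lemma metric_posdef:
  assumes "riemannian_manifold M" "c \<in> atlas M" "p \<in> dom_chart c"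
  shows "transpose (metric M c p) = metric M c p" "v \<noteq> 0 \<Longrightarrow> v \<bullet> (metric M c p *v v) > 0"
  using assms by (auto simp: riemannian_manifold_def riemannian_metric_def)

lemma riemannian_chart_function_on:
  assumes M: "riemannian_manifold M" and c: "c \<in> atlas M" and \<Omega>: "open \<Omega>"
    and u: "C_on_manifold M 3 u \<Omega>"
  shows "riemannian_chart_function M c (coords c ` (\<Omega> \<inter> dom_chart c)) u"
proof unfold_locales
  show U: "open (coords c ` (\<Omega> \<inter> dom_chart c))" by (rule open_chart_image[OF M c \<Omega>])
  show "C_on k (\<lambda>x. gram M c x $ i $ j) (coords c ` (\<Omega> \<inter> dom_chart c))" for k i j
  proof -
    have "C_on k (gram M c) (coords c ` dom_chart c)"
      using M c by (simp add: riemannian_manifold_def riemannian_metric_def smooth_on_def gram_def)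
    then have "C_on k (gram M c) (coords c ` (\<Omega> \<inter> dom_chart c))"
      by (rule C_on_subset) auto
    moreover have "bounded_linear (\<lambda>A::real^'b^'b. A $ i $ j)"
      by (intro bounded_linear_compose[OF bounded_linear_vec_nth] bounded_linear_vec_nth)
    ultimately show ?thesis using C_on_bounded_linear[OF _ U] by blast
  qed
  show "transpose (gram M c x) = gram M c x" if "x \<in> coords c ` (\<Omega> \<inter> dom_chart c)" for x
    using that metric_posdef[OF M c] by (auto simp: gram_coords[OF M c])
  show "v \<bullet> (gram M c x *v v) > 0" if "x \<in> coords c ` (\<Omega> \<inter> dom_chart c)" "v \<noteq> 0" for x v
    using that metric_posdef[OF M c] by (auto simp: gram_coords[OF M c])
  show "C_on 3 (in_chart c u) (coords c ` (\<Omega> \<inter> dom_chart c))"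
    using u c by (simp add: C_on_manifold_def)
qed

text \<open>The metric lowers the gradient back to du, so its squared norm is du(\<nabla>u), the
  form in which \<open>w\<close> is defined.\<close>

lemma tangent_norm_gradient:
  assumes M: "riemannian_manifold M" and c: "c \<in> atlas M" and p: "p \<in> dom_chart c"
  shows "tangent_norm M c p (gradient M c u (coords c p))
    = sqrt ((\<chi> j. pd j (in_chart c u) (coords c p)) \<bullet> gradient M c u (coords c p))"
proof -
  have "invertible (metric M c p)" using posdef_invertible metric_posdef[OF M c p] by blast
  then have "metric M c p *v gradient M c u (coords c p) = (\<chi> j. pd j (in_chart c u) (coords c p))"
    by (simp add: gradient_def gram_inv_def gram_coords[OF M c p] matrix_vector_mul_assoc matrix_inv_mult)
  then show ?thesis by (simp add: tangent_norm_def inner_commute)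
qed

text \<open>\<open>grad_norm\<close> may select a different chart at every point, whereas the
  maximum is studied in one chart around \<open>y0\<close>. The chain rule relates the differentials
  by the transposed Jacobian and \<open>inner_inverse_congruence\<close> concludes.\<close>

lemma tangent_norm_gradient_chart_independent:
  assumes M: "riemannian_manifold M" and \<Omega>: "open \<Omega>" "p \<in> \<Omega>" and u: "C_on_manifold M 3 u \<Omega>"
    and c: "c \<in> atlas M" "p \<in> dom_chart c" and c': "c' \<in> atlas M" "p \<in> dom_chart c'"
  shows "tangent_norm M c p (gradient M c u (coords c p))
    = tangent_norm M c' p (gradient M c' u (coords c' p))"
proof -
  let ?W = "coords c ` (dom_chart c' \<inter> dom_chart c)" and ?x = "coords c p" and ?x' = "coords c' p"
  define J where "J = matrix (frechet_derivative (transition c c') (at ?x))"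
  have W: "open ?W" "?x \<in> ?W"
    using open_chart_image[OF M c(1)] chart_homeomorphism(1)[OF M c'(1)] c c' by auto
  have \<tau>x: "transition c c' ?x = ?x'"
    by (simp add: transition_def in_chart_def uncoords_coords[OF M c])
  have "C_on 1 (transition c c') ?W"
    using M c(1) c'(1) unfolding riemannian_manifold_def smooth_atlas_def smooth_on_def
    by (metis Int_commute)
  then have \<tau>: "transition c c' differentiable (at ?x)"
    using W(2) unfolding One_nat_def C_on.simps by blast
  interpret c: riemannian_chart_function M c "coords c ` (\<Omega> \<inter> dom_chart c)" u
    by (rule riemannian_chart_function_on[OF M c(1) \<Omega>(1) u])
  interpret c': riemannian_chart_function M c' "coords c' ` (\<Omega> \<inter> dom_chart c')" u
    by (rule riemannian_chart_function_on[OF M c'(1) \<Omega>(1) u])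
  have f: "in_chart c u differentiable (at ?x)" using c.differentiable_u c \<Omega> by simp
  have f': "in_chart c' u differentiable (at ?x')" using c'.differentiable_u c' \<Omega> by simp
  have comp: "in_chart c u x = (in_chart c' u \<circ> transition c c') x" if "x \<in> ?W" for x
    using that uncoords_coords[OF M c(1)] uncoords_coords[OF M c'(1)]
    by (auto simp: in_chart_def transition_def)
  have df: "pd j (in_chart c u) ?x = (\<Sum>i\<in>UNIV. J $ i $ j * pd i (in_chart c' u) ?x')" for j
  proof -
    have "frechet_derivative (in_chart c u) (at ?x) = frechet_derivative (in_chart c' u \<circ> transition c c') (at ?x)"
      by (rule frechet_derivative_transform_within_open[OF f W comp])
    also have "\<dots> = frechet_derivative (in_chart c' u) (at ?x') \<circ> frechet_derivative (transition c c') (at ?x)"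
      using frechet_derivative_compose[of "transition c c'" ?x "in_chart c' u"] \<tau> f' by (simp add: \<tau>x)
    finally show ?thesis
      by (simp add: pd_def[of j] frechet_derivative_eq_sum_pd[OF f'] J_def matrix_def)
  qed
  have G: "metric M c p = transpose J ** metric M c' p ** J"
    using M c c' unfolding riemannian_manifold_def riemannian_metric_def J_def Let_def by blast
  have inv: "invertible (metric M c p)" "invertible (metric M c' p)"
    using posdef_invertible metric_posdef[OF M c] metric_posdef[OF M c'] by blast+
  have "(\<chi> j. pd j (in_chart c u) ?x) = transpose J *v (\<chi> j. pd j (in_chart c' u) ?x')"
    by (simp add: vec_eq_iff matrix_vector_mult_def transpose_def df)
  from inner_inverse_congruence[OF G inv this] show ?thesis
    unfolding tangent_norm_gradient[OF M c] tangent_norm_gradient[OF M c']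
    by (simp add: gradient_def gram_inv_def gram_coords[OF M c] gram_coords[OF M c'])
qed

text \<open>Makes the real infimum in \<open>ricci_minus\<close> meaningful. The quotient of the two
  forms is invariant under scaling, so its minimum on the compact Euclidean sphere bounds it on the
  unit sphere of \<open>G\<close>.\<close>

lemma quadratic_form_bdd_below_on_unit:
  fixes G R :: "real^'n^'n"
  assumes G: "\<And>v. v \<noteq> 0 \<Longrightarrow> v \<bullet> (G *v v) > 0"
  shows "\<exists>m. \<forall>\<eta>. \<eta> \<bullet> (G *v \<eta>) = 1 \<longrightarrow> m \<le> \<eta> \<bullet> (R *v \<eta>)"
proof -
  let ?r = "\<lambda>v. (v \<bullet> (R *v v)) / (v \<bullet> (G *v v))"
  have nz: "v \<bullet> (G *v v) \<noteq> 0" if "v \<in> sphere 0 1" for v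
    using G[of v] that by force
  have "continuous_on (sphere 0 1) ?r"
    using nz by (intro continuous_intros matrix_vector_mult_linear_continuous_on) auto
  moreover have "sphere (0::real^'n) 1 \<noteq> {}"
    using norm_axis_1[of undefined] by (metis dist_0_norm empty_iff mem_sphere)
  ultimately obtain v0 where v0: "\<And>v. v \<in> sphere 0 1 \<Longrightarrow> ?r v0 \<le> ?r v"
    using continuous_attains_inf[OF compact_sphere, of 0 1 ?r] by blast
  have "?r v0 \<le> \<eta> \<bullet> (R *v \<eta>)" if \<eta>: "\<eta> \<bullet> (G *v \<eta>) = 1" for \<eta>
  proof -
    have n: "norm \<eta> \<noteq> 0" using \<eta> by auto
    have "?r v0 \<le> ?r (inverse (norm \<eta>) *\<^sub>R \<eta>)" using n by (intro v0) simp
    also have "\<dots> = \<eta> \<bullet> (R *v \<eta>)"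
      using n \<eta> by (simp add: scaleR_matrix_vector_assoc[symmetric] matrix_vector_mult_scaleR)
    finally show ?thesis .
  qed
  then show ?thesis by blast
qed

lemma ricci_minus_le:
  assumes M: "riemannian_manifold M" and \<eta>: "tangent_norm M (chart_at M p) p \<eta> = 1"
  shows "ricci_minus M p \<le> min (\<eta> \<bullet> (ricci M (chart_at M p) (coords (chart_at M p) p) *v \<eta>)) 0"
proof -
  let ?c = "chart_at M p" and ?R = "ricci M (chart_at M p) (coords (chart_at M p) p)"
  obtain m where "\<And>\<eta>. \<eta> \<bullet> (metric M ?c p *v \<eta>) = 1 \<Longrightarrow> m \<le> \<eta> \<bullet> (?R *v \<eta>)"
    using quadratic_form_bdd_below_on_unit[of "metric M ?c p" ?R] metric_posdef[OF M chart_atI[OF M]] by blast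
  then have "bdd_below ((\<lambda>\<eta>. min (\<eta> \<bullet> (?R *v \<eta>)) 0) ` {\<eta>. tangent_norm M ?c p \<eta> = 1})"
    by (intro bdd_belowI[of _ "min m 0"]) (auto simp: tangent_norm_def min_def intro: order_trans)
  then show ?thesis unfolding ricci_minus_def Let_def using \<eta> by (intro cINF_lower) auto
qed

section \<open>Reduction to one chart and the contradiction\<close>

theorem theorem13:
  fixes M :: "('m::{t2_space, second_countable_topology}, 'n::finite) riemannian_structure"
    and \<Omega> :: "'m set" and u :: "'m \<Rightarrow> real" and y0 :: 'm
    and a b :: "real \<Rightarrow> real" and \<alpha> s0 K :: real
  assumes "riemannian_manifold M" and "complete_riemannian M" and "bounded_domain M \<Omega>"
    and "continuous_on {0..} a" and "C_on 2 a {0<..}"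
    and "\<And>s. s > 0 \<Longrightarrow> a s > 0" and "\<And>s. s > 0 \<Longrightarrow> deriv a s > 0"
    and "\<And>s. s > 0 \<Longrightarrow> b s = s * deriv a s / a s - 1"
    and "\<alpha> > 0" and "s0 > 0"
    and "\<And>s. s \<ge> s0 \<Longrightarrow> (- deriv b s * s - (b s + 1)) * s\<^sup>2 \<ge> \<alpha>"
    and "K > 0"
    and "ereal K > ereal_sqrt (ereal (1 / \<alpha>) * (SUP p\<in>\<Omega>. ereal \<bar>ricci_minus M p\<bar>))"
    and "C_on_manifold M 3 u \<Omega>" and "solves_in M \<Omega> b u"
    and "y0 \<in> \<Omega>"
    and "\<forall>\<^sub>F y in nhds y0. exp (K * u y) * grad_norm M u y \<le> exp (K * u y0) * grad_norm M u y0"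
  shows "grad_norm M u y0 \<le> s0"
proof (rule ccontr)
  note M = assms(1) and C2a = assms(5) and a_pos = assms(6) and a'_pos = assms(7) and b_def = assms(8)
    and \<alpha> = assms(9) and s0 = assms(10) and decay = assms(11) and K = assms(12) and K_large = assms(13)
    and u = assms(14) and solves = assms(15) and y0 = assms(16) and max = assms(17)
  assume "\<not> grad_norm M u y0 \<le> s0"
  then have s_gt: "grad_norm M u y0 > s0" by simp
  have \<Omega>: "open \<Omega>" using assms(3) by (simp add: bounded_domain_def)
  define c where "c = chart_at M y0"
  define U where "U = coords c ` (\<Omega> \<inter> dom_chart c)"
  define x0 where "x0 = coords c y0"
  have c: "c \<in> atlas M" "y0 \<in> dom_chart c" unfolding c_def by (rule chart_atI[OF M])+
  interpret riemannian_chart_function M c U u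
    unfolding U_def by (rule riemannian_chart_function_on[OF M c(1) \<Omega> u])
  have x0: "x0 \<in> U" using y0 c by (simp add: x0_def U_def)
  have grad: "gradient M c u x $ i = X i x" for x i
    by (simp add: gradient_def matrix_vector_mult_def X_def)
  have norm_eq: "tangent_norm M c p (gradient M c u (coords c p)) = sqrt (w (coords c p))"
    if "p \<in> dom_chart c" for p
    unfolding tangent_norm_gradient[OF M c(1) that] by (simp add: inner_vec_def grad w_def)
  have grad_norm_eq: "grad_norm M u p = sqrt (w (coords c p))" if "p \<in> \<Omega>" "p \<in> dom_chart c" for p
    unfolding grad_norm_def Let_def norm_eq[OF that(2), symmetric]
    by (rule tangent_norm_gradient_chart_independent[OF M \<Omega> that(1) u chart_atI[OF M] c(1) that(2)])
  have w_nonneg: "w x \<ge> 0" if "x \<in> U" for x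
    unfolding sum_h_df_df[symmetric] by (rule h_quadratic_nonneg[OF that])
  define s where "s = sqrt (w x0)"
  have s_eq: "s = grad_norm M u y0" using grad_norm_eq[OF y0 c(2)] by (simp add: s_def x0_def)
  have s: "s > s0" "s > 0" using s_gt s0 by (auto simp: s_eq)
  have w_pos: "w x0 > 0" using s(2) by (simp add: s_def)
  have w_eq: "w x0 = s\<^sup>2" using w_pos by (simp add: s_def)
  \<comment> \<open>Squaring keeps the inequality because the maximised function is
    nonnegative.\<close>
  have max_chart: "\<forall>\<^sub>F x in nhds x0. exp (2 * K * in_chart c u x) * w x \<le> exp (2 * K * in_chart c u x0) * w x0"
  proof -
    obtain S where S: "open S" "y0 \<in> S" "\<And>y. y \<in> S \<Longrightarrow>
        exp (K * u y) * grad_norm M u y \<le> exp (K * u y0) * grad_norm M u y0"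
      using max unfolding eventually_nhds by blast
    have "exp (2 * K * in_chart c u x) * w x \<le> exp (2 * K * in_chart c u x0) * w x0"
      if x: "x \<in> coords c ` ((S \<inter> \<Omega>) \<inter> dom_chart c)" for x
    proof -
      have sq: "exp (2 * K * in_chart c u (coords c p)) * w (coords c p) = (exp (K * u p) * grad_norm M u p)\<^sup>2"
        if "p \<in> \<Omega>" "p \<in> dom_chart c" for p
        using w_nonneg[of "coords c p"] that
        by (simp add: grad_norm_eq[OF that] in_chart_def uncoords_coords[OF M c(1) that(2)] U_def
            power_mult_distrib exp_of_nat_mult[of 2, symmetric] mult.assoc)
      obtain p where p: "p \<in> S" "p \<in> \<Omega>" "p \<in> dom_chart c" "x = coords c p" using x by blast
      have "0 \<le> exp (K * u p) * grad_norm M u p"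
        using w_nonneg[of "coords c p"] p by (simp add: grad_norm_eq U_def)
      from power_mono[OF S(3)[OF p(1)] this, of 2] show ?thesis
        unfolding p(4) x0_def sq[OF p(2,3)] sq[OF y0 c(2)] .
    qed
    moreover have "open (coords c ` ((S \<inter> \<Omega>) \<inter> dom_chart c))"
      using S(1) \<Omega> by (intro open_chart_image[OF M c(1)] open_Int)
    moreover have "x0 \<in> coords c ` ((S \<inter> \<Omega>) \<inter> dom_chart c)"
      using S(2) y0 c by (auto simp: x0_def)
    ultimately show ?thesis unfolding eventually_nhds by blast
  qed
  have equation: "w x * L x + b (sqrt (w x)) * Q x = 0" if x: "x \<in> U" for x
  proof -
    obtain p where p: "p \<in> \<Omega>" "p \<in> dom_chart c" "x = coords c p" using x by (auto simp: U_def)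
    have "gradient M c u x \<bullet> (hessian M c u x *v gradient M c u x) = Q x"
      by (simp add: inner_vec_def matrix_vector_mult_def grad hessian_def H_def[symmetric] P_eq[OF x])
    moreover have "(tangent_norm M c p (gradient M c u x))\<^sup>2 * laplacian M c u x
        + b (tangent_norm M c p (gradient M c u x))
          * (gradient M c u x \<bullet> (hessian M c u x *v gradient M c u x)) = 0"
      using solves p c(1) unfolding solves_in_def Let_def by blast
    ultimately show ?thesis
      using w_nonneg[OF x] by (simp add: norm_eq[OF p(2), folded p(3)] laplacian_eq[OF x])
  qed
  \<comment> \<open>Two derivatives of \<open>a\<close> are needed, as \<open>b\<close> already
    contains the first. The class C^2 is phrased with \<open>frechet_derivative\<close>, hence the
    passage to \<open>deriv\<close>.\<close>
  have "b differentiable (at s)"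
  proof -
    have a: "(a has_real_derivative deriv a y) (at y)" if "y > 0" for y
      using C2a that DERIV_deriv_iff_real_differentiable by (auto simp: numeral_2_eq_2)
    have "frechet_derivative a (at y) 1 = deriv a y" if "y \<in> {0<..}" for y
      using frechet_derivative_at[OF a[unfolded has_field_derivative_def], of y] that by (metis greaterThan_iff mult.right_neutral)
    moreover have "C_on 1 (\<lambda>y. frechet_derivative a (at y) 1) {0<..}"
      using C2a by (simp add: numeral_2_eq_2)
    ultimately have "C_on 1 (deriv a) {0<..}" by (rule C_on_cong[OF open_greaterThan])
    then have "deriv a differentiable (at s)" using s by simp
    then have "(\<lambda>y. y * deriv a y / a y - 1) differentiable (at s)"
      using a[OF s(2)] a_pos[OF s(2)] real_differentiable_def
      by (intro differentiable_diff differentiable_divide differentiable_mult) auto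
    then obtain D where "((\<lambda>y. y * deriv a y / a y - 1) has_real_derivative D) (at s)"
      using real_differentiable_def by blast
    then have "(b has_real_derivative D) (at s)"
      by (rule has_field_derivative_transform_within_open[of _ _ _ "{0<..}"]) (use s b_def in auto)
    then show ?thesis using real_differentiable_def by blast
  qed
  then have b': "(b has_real_derivative deriv b s) (at s)"
    by (simp add: DERIV_deriv_iff_real_differentiable)
  \<comment> \<open>\<open>b s + 1\<close> equals \<open>s * deriv a s / a s\<close>.\<close>
  have b_gt: "b s > - 1"
    using s a_pos a'_pos by (simp add: b_def)
  have ineq: "qform (\<lambda>i j. ricci M c x0 $ i $ j) (\<lambda>i. X i x0) (\<lambda>i. X i x0)
      + K\<^sup>2 * (s\<^sup>2)\<^sup>2 * (- deriv b s * s - (b s + 1)) \<le> 0"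
    using interior_max_inequality[OF x0 w_pos max_chart equation b'[unfolded s_def] b_gt[unfolded s_def]]
    unfolding s_def[symmetric] unfolding w_eq .
  have "\<bar>ricci_minus M y0\<bar> < \<alpha> * K\<^sup>2"
  proof -
    define r where "r = \<bar>ricci_minus M y0\<bar>"
    define S where "S = (SUP p\<in>\<Omega>. ereal \<bar>ricci_minus M p\<bar>)"
    have rS: "ereal r \<le> S" unfolding r_def S_def by (rule SUP_upper[OF y0])
    \<comment> \<open>The supremum is extended real; a finite \<open>K\<close> above its root rules
      out an infinite value.\<close>
    have "S \<noteq> \<infinity>" using K_large \<alpha> unfolding S_def[symmetric] by (auto simp: ereal_sqrt_def)
    moreover have "S \<noteq> - \<infinity>" using rS by auto
    ultimately obtain q where q: "S = ereal q" by (cases S) auto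
    have "sqrt (q / \<alpha>) < K" using K_large unfolding S_def[symmetric] q by (simp add: ereal_sqrt_def)
    moreover have "r \<le> q" using rS q by simp
    ultimately have "sqrt (r / \<alpha>) < K" using \<alpha> by (smt (verit) divide_right_mono real_sqrt_le_mono)
    then have "r / \<alpha> < K\<^sup>2" using K by (metis real_sqrt_less_iff real_sqrt_unique less_imp_le)
    then show ?thesis using \<alpha> by (simp add: r_def field_simps)
  qed
  moreover have "qform (\<lambda>i j. ricci M c x0 $ i $ j) (\<lambda>i. X i x0) (\<lambda>i. X i x0)
      \<ge> s\<^sup>2 * - \<bar>ricci_minus M y0\<bar>"
  proof -
    let ?X = "gradient M c u x0"
    \<comment> \<open>Normalised, since \<open>ricci_minus\<close> sees unit vectors only; scaling
      back costs the factor \<open>s\<^sup>2\<close>.\<close>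
    define \<eta> where "\<eta> = inverse s *\<^sub>R ?X"
    have tX: "tangent_norm M c y0 ?X = s" using norm_eq[OF c(2)] by (simp add: x0_def s_def)
    have "tangent_norm M c y0 \<eta> = inverse s * tangent_norm M c y0 ?X"
      using s(2) by (simp add: \<eta>_def tangent_norm_def matrix_vector_mult_scaleR real_sqrt_mult)
    then have "tangent_norm M c y0 \<eta> = 1" using tX s(2) by simp
    from ricci_minus_le[OF M this[unfolded c_def]]
    have "- \<bar>ricci_minus M y0\<bar> \<le> \<eta> \<bullet> (ricci M c x0 *v \<eta>)" by (simp add: c_def x0_def)
    then have "s\<^sup>2 * - \<bar>ricci_minus M y0\<bar> \<le> s\<^sup>2 * (\<eta> \<bullet> (ricci M c x0 *v \<eta>))"
      by (intro mult_left_mono) auto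
    also have "\<dots> = ?X \<bullet> (ricci M c x0 *v ?X)"
      using s(2) by (simp add: \<eta>_def matrix_vector_mult_scaleR power2_eq_square inverse_eq_divide)
    also have "\<dots> = qform (\<lambda>i j. ricci M c x0 $ i $ j) (\<lambda>i. X i x0) (\<lambda>i. X i x0)"
      by (simp add: inner_vec_def matrix_vector_mult_def grad sum_distrib_left ac_simps)
    finally show ?thesis .
  qed
  moreover have "K\<^sup>2 * (s\<^sup>2)\<^sup>2 * (- deriv b s * s - (b s + 1)) \<ge> s\<^sup>2 * (\<alpha> * K\<^sup>2)"
  proof -
    have "0 \<le> K\<^sup>2 * s\<^sup>2" by simp
    \<comment> \<open>One of the two factors \<open>s\<^sup>2\<close> is absorbed by the hypothesis
      on \<open>b\<close>, the other matches the factor in the Ricci bound.\<close>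
    from mult_left_mono[OF decay[OF less_imp_le[OF s(1)]] this] show ?thesis
      by (simp only: power2_eq_square ac_simps)
  qed
  moreover have "s\<^sup>2 * \<bar>ricci_minus M y0\<bar> < s\<^sup>2 * (\<alpha> * K\<^sup>2)" if "\<bar>ricci_minus M y0\<bar> < \<alpha> * K\<^sup>2"
    using that s by simp
  ultimately show False using ineq by simp
qed

end
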